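(* Let $F:\Sigma\to\Sigma$, $F(x,z)=(f(x),G(x,z))$, be a skew product satisfying all the assumptions on the base map $f$ and on the fiber map $G$ listed in the context. Then there exists a unique $F$-invariant probability measure $\mu_0$ belonging to $S^\infty$. Moreover $\pi_{x*}\mu_0=m_1$.
   Context: Base map. Fix $0<\zeta<1$. $M$ is a compact connected Riemannian manifold with Riemannian distance $d_1$ and $\operatorname{diam}(M)=1$. For $h:M\to\mathbb R$ put $H_\zeta(h)=\sup_{x\neq y}|h(x)-h(y)|/d_1(x,y)^\zeta$, $H_\zeta=\{h:H_\zeta(h)<\infty\}$, $|h|_\zeta=H_\zeta(h)+|h|_\infty$. The map $f:M\to M$ is a local diffeomorphism and there is a continuous $\ell:M\to\mathbb R$ such that every $x\in M$ has a neighbourhood $U_x$ on which $f_x:=f|_{U_x}:U_x\to f(U_x)$ is invertible with $d_1(f_x^{-1}(y),f_x^{-1}(z))\le \ell(x)\,d_1(y,z)$ for $y,z\in f(U_x)$; $\deg(f)=\#f^{-1}(x)$ (constant in $x$). There are an open set $\mathcal A\subset M$ and constants $\sigma>1$, $L\ge 1$, $\epsilon_\rho>0$ and an integer $q<\deg(f)$ with: (f1) $\ell(x)\le L$ for $x\in\mathcal A$ and $\ell(x)<\sigma^{-1}$ for $x\notin\mathcal A$; (f2) there is a finite covering of $M$ by open domains of injectivity of $f$ such that $\mathcal A$ can be covered by $q$ of them; (f3) $\sup\log\rho-\inf\log\rho<\epsilon_\rho$ and $H_\zeta(\rho)<\epsilon_\rho\inf\rho$; and $e^{\epsilon_\rho}\cdot\frac{(\deg(f)-q)\sigma^{-\zeta}+qL^\zeta[1+(L-1)^\zeta]}{\deg(f)}<1$.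 Here $m_1$ is the $f$-invariant Borel probability of maximal entropy, absolutely continuous with respect to a conformal measure (known to exist for such $f$), and $\rho=1/|\det f'|$, where $|\det f'|$ is the Jacobian of $f$ with respect to $m_1$. The Perron-Frobenius operator with respect to $m_1$ is $P_f(\varphi)(x)=\sum_{i=1}^{\deg(f)}\varphi(x_i)\rho(x_i)$, where $x_1,\dots,x_{\deg(f)}$ are the preimages of $x$; since $m_1$ is invariant, $P_f1=1$. It is known that there are $0<r<1$, $D>0$ with $|P_f^n\varphi|_\zeta\le Dr^n|\varphi|_\zeta$ for all $n\ge1$ and all $\varphi\in H_\zeta$ with $\int\varphi\,dm_1=0$. Fiber map. $(K,d_2)$ is a compact metric space, $\Sigma=M\times K$ with metric $d_1+d_2$, $G:\Sigma\to K$ is measurable, and (G1): there is $0<\alpha<1$ such that for $m_1$-a.e. $x\in M$, $d_2(G(x,z_1),G(x,z_2))\le\alpha\, d_2(z_1,z_2)$ for all $z_1,z_2\in K$. Measures. $\pi_x(x,y)=x$, $\pi_y(x,y)=y$. $\mathcal{AB}$ is the set of signed Borel measures $\mu$ on $\Sigma$, with Jordan decomposition $\mu=\mu^+-\mu^-$, such that $\pi_{x*}\mu^\pm\ll m_1$. A positive $\mu\in\mathcal{AB}$ has a Rokhlin disintegration $(\{\mu_\gamma\}_{\gamma\in M},\phi_xm_1)$ along the leaves $\{\gamma\}\times K$, with $\mu_\gamma$ a probability on $\{\gamma\}\times K$ and $\phi_x=d(\pi_{x*}\mu)/dm_1$; the restriction is the measure on $K$ given by $\mu|_\gamma=\pi_{y*}(\phi_x(\gamma)\mu_\gamma)$.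 For signed $\mu\in\mathcal{AB}$, $\mu|_\gamma=\mu^+|_\gamma-\mu^-|_\gamma$ and $\phi_x=\phi_x^+-\phi_x^-$, where $\phi_x^\pm$ are the marginal densities of $\mu^\pm$. For a signed measure $\nu$ on $K$, $\|\nu\|_W=\sup\{|\int g\,d\nu|: |g|_\infty\le1,\ H_\zeta(g)\le1\}$, with $g:K\to\mathbb R$ and $H_\zeta(g)$ the best $\zeta$-Hölder constant of $g$. $\mathcal L^\infty=\{\mu\in\mathcal{AB}:\|\mu\|_\infty<\infty\}$ with $\|\mu\|_\infty=\operatorname{ess\,sup}_\gamma\|\mu|_\gamma\|_W$ (with respect to $m_1$), and $S^\infty=\{\mu\in\mathcal L^\infty:\phi_x\in H_\zeta\}$ (i.e. $\phi_x$ has a version in $H_\zeta$) with norm $\|\mu\|_{S^\infty}=|\phi_x|_\zeta+\|\mu\|_\infty$. *)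

theory Defs
  imports "HOL-Probability.Probability"
begin

text \<open>\<open>Ck_on k h S\<close> is meant for open \<open>S\<close>: all iterated directional derivatives up to order \<open>k\<close>
  exist (as Frechet derivatives) and are continuous.\<close>

primrec Ck_on :: "nat \<Rightarrow> ('a::euclidean_space \<Rightarrow> 'b::real_normed_vector) \<Rightarrow> 'a set \<Rightarrow> bool" where
  "Ck_on 0 h S \<longleftrightarrow> continuous_on S h"
| "Ck_on (Suc k) h S \<longleftrightarrow> (\<forall>x\<in>S. h differentiable (at x)) \<and>
     (\<forall>v. Ck_on k (\<lambda>x. frechet_derivative h (at x) v) S)"

definition smooth_on :: "'a set \<Rightarrow> ('a::euclidean_space \<Rightarrow> 'b::real_normed_vector) \<Rightarrow> bool" where
  "smooth_on S h \<longleftrightarrow> (\<forall>k. Ck_on k h S)"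

text \<open>A chart is a pair of its domain and its coordinate map; the model space \<open>'e\<close> fixes the dimension.\<close>

type_synonym ('m, 'e) chart = "'m set \<times> ('m \<Rightarrow> 'e)"

definition smooth_atlas :: "('m::topological_space, 'e::euclidean_space) chart set \<Rightarrow> bool" where
  "smooth_atlas C \<longleftrightarrow> (\<Union>c\<in>C. fst c) = UNIV \<and>
     (\<forall>(U, \<phi>)\<in>C. open U \<and> open (\<phi> ` U) \<and> (\<exists>\<psi>. homeomorphism U (\<phi> ` U) \<phi> \<psi>)) \<and>
     (\<forall>(U, \<phi>)\<in>C. \<forall>(V, \<psi>)\<in>C. smooth_on (\<phi> ` (U \<inter> V)) (\<psi> \<circ> inv_into U \<phi>))"

text \<open>A metric tensor is given by its coordinate expressions \<open>g c x v w\<close> in the charts \<open>c\<close>,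
  which have to transform as a covariant 2-tensor.\<close>

type_synonym ('m, 'e) metric_tensor = "('m, 'e) chart \<Rightarrow> 'm \<Rightarrow> 'e \<Rightarrow> 'e \<Rightarrow> real"

definition riemannian_metric ::
  "('m::topological_space, 'e::euclidean_space) chart set \<Rightarrow> ('m, 'e) metric_tensor \<Rightarrow> bool" where
  "riemannian_metric C g \<longleftrightarrow>
     (\<forall>c\<in>C. \<forall>x\<in>fst c. bilinear (g c x) \<and> (\<forall>v w. g c x v w = g c x w v) \<and> (\<forall>v. v \<noteq> 0 \<longrightarrow> 0 < g c x v v)) \<and>
     (\<forall>(U, \<phi>)\<in>C. \<forall>v w. smooth_on (\<phi> ` U) (\<lambda>p. g (U, \<phi>) (inv_into U \<phi> p) v w)) \<and>
     (\<forall>(U, \<phi>)\<in>C. \<forall>(V, \<psi>)\<in>C. \<forall>x\<in>U \<inter> V. \<forall>v w.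
        g (U, \<phi>) x v w =
        g (V, \<psi>) x (frechet_derivative (\<psi> \<circ> inv_into U \<phi>) (at (\<phi> x)) v)
                   (frechet_derivative (\<psi> \<circ> inv_into U \<phi>) (at (\<phi> x)) w))"

text \<open>As for \<^const>\<open>piecewise_C1_differentiable_on\<close>, derivatives need not be bounded near the break
  points. Such a curve has (possibly infinite) length given by the integral of its speed, so the
  infimum defining the Riemannian distance is not affected.\<close>

definition piecewise_C1_curve ::
  "('m::topological_space, 'e::euclidean_space) chart set \<Rightarrow> (real \<Rightarrow> 'm) \<Rightarrow> bool" where
  "piecewise_C1_curve C c \<longleftrightarrow> continuous_on {0..1} c \<and>
     (\<exists>S. finite S \<and> {0, 1} \<subseteq> S \<and>
        (\<forall>(U, \<phi>)\<in>C. (\<phi> \<circ> c) C1_differentiable_on ({0..1} \<inter> c -` U - S)))"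

text \<open>The speed does not depend on the chart chosen, because the metric tensor is compatible
  with the changes of coordinates.\<close>

definition curve_speed ::
  "('m, 'e::euclidean_space) chart set \<Rightarrow> ('m, 'e) metric_tensor \<Rightarrow> (real \<Rightarrow> 'm) \<Rightarrow> real \<Rightarrow> real" where
  "curve_speed C g c t =
     (let k = (SOME k. k \<in> C \<and> c t \<in> fst k); v = vector_derivative (snd k \<circ> c) (at t)
      in sqrt (g k (c t) v v))"

definition curve_length ::
  "('m, 'e::euclidean_space) chart set \<Rightarrow> ('m, 'e) metric_tensor \<Rightarrow> (real \<Rightarrow> 'm) \<Rightarrow> ennreal" where
  "curve_length C g c = (\<integral>\<^sup>+t\<in>{0..1}. ennreal (curve_speed C g c t) \<partial>lborel)"

text \<open>The type \<open>'m\<close> is a Riemannian manifold whose metric \<^term>\<open>dist\<close> is the Riemannian distance.\<close>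

definition riemannian_manifold ::
  "('m::metric_space, 'e::euclidean_space) chart set \<Rightarrow> ('m, 'e) metric_tensor \<Rightarrow> bool" where
  "riemannian_manifold C g \<longleftrightarrow> smooth_atlas C \<and> riemannian_metric C g \<and>
     (\<forall>x y. ennreal (dist x y) =
        (INF c\<in>{c. piecewise_C1_curve C c \<and> c 0 = x \<and> c 1 = y}. curve_length C g c))"

definition C1_map_on ::
  "('m::topological_space, 'e::euclidean_space) chart set \<Rightarrow> ('m \<Rightarrow> 'm) \<Rightarrow> 'm set \<Rightarrow> bool" where
  "C1_map_on C h W \<longleftrightarrow> continuous_on W h \<and>
     (\<forall>(U, \<phi>)\<in>C. \<forall>(V, \<psi>)\<in>C. Ck_on 1 (\<psi> \<circ> h \<circ> inv_into U \<phi>) (\<phi> ` (U \<inter> W \<inter> h -` V)))"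

definition local_diffeomorphism ::
  "('m::topological_space, 'e::euclidean_space) chart set \<Rightarrow> ('m \<Rightarrow> 'm) \<Rightarrow> bool" where
  "local_diffeomorphism C f \<longleftrightarrow>
     (\<forall>x. \<exists>W. open W \<and> x \<in> W \<and> open (f ` W) \<and> inj_on f W \<and>
          C1_map_on C f W \<and> C1_map_on C (inv_into W f) (f ` W))"

definition holder_const :: "real \<Rightarrow> ('a::metric_space \<Rightarrow> real) \<Rightarrow> ennreal" where
  "holder_const \<zeta> h = (SUP (x, y)\<in>{(x, y). x \<noteq> y}. ennreal (\<bar>h x - h y\<bar> / dist x y powr \<zeta>))"

definition holder_space :: "real \<Rightarrow> ('a::metric_space \<Rightarrow> real) set" where
  "holder_space \<zeta> = {h. holder_const \<zeta> h < \<infinity>}"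

definition holder_norm :: "real \<Rightarrow> ('a::metric_space \<Rightarrow> real) \<Rightarrow> ennreal" where
  "holder_norm \<zeta> h = holder_const \<zeta> h + (SUP x. ennreal \<bar>h x\<bar>)"

text \<open>The number of preimages of a point, when it is the same for all points.\<close>

definition map_degree :: "('m \<Rightarrow> 'm) \<Rightarrow> nat" where
  "map_degree f = (THE d. \<forall>x. finite (f -` {x}) \<and> card (f -` {x}) = d)"

definition invariant_borel_prob :: "('a::topological_space \<Rightarrow> 'a) \<Rightarrow> 'a measure \<Rightarrow> bool" where
  "invariant_borel_prob T \<mu> \<longleftrightarrow>
     prob_space \<mu> \<and> sets \<mu> = sets borel \<and> T \<in> borel \<rightarrow>\<^sub>M borel \<and> distr \<mu> borel T = \<mu>"

text \<open>Kolmogorov-Sinai entropy, with natural logarithm. Empty cells of the join contribute 0,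
  since \<open>0 * ln 0 = 0\<close>; the limit exists for invariant \<open>\<mu>\<close> by subadditivity.\<close>

definition partition_entropy :: "'a measure \<Rightarrow> 'a set set \<Rightarrow> real" where
  "partition_entropy \<mu> P = - (\<Sum>A\<in>P. measure \<mu> A * ln (measure \<mu> A))"

definition dynamical_join :: "('a \<Rightarrow> 'a) \<Rightarrow> 'a set set \<Rightarrow> nat \<Rightarrow> 'a set set" where
  "dynamical_join T P n = (\<lambda>A. \<Inter>i<n. (T ^^ i) -` A i) ` ({..<n} \<rightarrow>\<^sub>E P)"

definition metric_entropy :: "'a measure \<Rightarrow> ('a \<Rightarrow> 'a) \<Rightarrow> ereal" where
  "metric_entropy \<mu> T =
     (SUP P\<in>{P. finite P \<and> P \<subseteq> sets \<mu> \<and> partition_on (space \<mu>) P}.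
        ereal (lim (\<lambda>n. partition_entropy \<mu> (dynamical_join T P n) / real n)))"

definition maximal_entropy_measure :: "('a::topological_space \<Rightarrow> 'a) \<Rightarrow> 'a measure \<Rightarrow> bool" where
  "maximal_entropy_measure T \<mu> \<longleftrightarrow> invariant_borel_prob T \<mu> \<and>
     (\<forall>\<nu>. invariant_borel_prob T \<nu> \<longrightarrow> metric_entropy \<nu> T \<le> metric_entropy \<mu> T)"

definition jacobian_wrt :: "'a::topological_space measure \<Rightarrow> ('a \<Rightarrow> 'a) \<Rightarrow> ('a \<Rightarrow> real) \<Rightarrow> bool" where
  "jacobian_wrt \<mu> T J \<longleftrightarrow> J \<in> borel_measurable borel \<and> (\<forall>x. 0 < J x) \<and>
     (\<forall>A\<in>sets borel. inj_on T A \<longrightarrow> emeasure \<mu> (T ` A) = (\<integral>\<^sup>+x\<in>A. ennreal (J x) \<partial>\<mu>))"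

definition conformal_measure :: "('a::topological_space \<Rightarrow> 'a) \<Rightarrow> 'a measure \<Rightarrow> bool" where
  "conformal_measure T \<nu> \<longleftrightarrow> prob_space \<nu> \<and> sets \<nu> = sets borel \<and>
     (\<exists>\<psi>. jacobian_wrt \<nu> T (\<lambda>x. exp (- \<psi> x)))"

definition perron_frobenius ::
  "('m \<Rightarrow> 'm) \<Rightarrow> ('m \<Rightarrow> real) \<Rightarrow> ('m \<Rightarrow> real) \<Rightarrow> 'm \<Rightarrow> real" where
  "perron_frobenius f \<rho> \<phi> x = (\<Sum>y\<in>f -` {x}. \<phi> y * \<rho> y)"

text \<open>A (finite) signed Borel measure is a countably additive real set function on the Borel sets,
  with the convention that it is zero elsewhere; a finite Borel measure \<open>\<mu>\<close> is identified with
  the set function \<^term>\<open>measure \<mu>\<close>.\<close>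

definition signed_borel_measure :: "('a::topological_space set \<Rightarrow> real) \<Rightarrow> bool" where
  "signed_borel_measure \<mu> \<longleftrightarrow> \<mu> {} = 0 \<and> (\<forall>A. A \<notin> sets borel \<longrightarrow> \<mu> A = 0) \<and>
     (\<forall>A::nat \<Rightarrow> _. range A \<subseteq> sets borel \<longrightarrow> disjoint_family A \<longrightarrow>
        (\<lambda>i. \<mu> (A i)) sums \<mu> (\<Union>i. A i))"

definition jordan_decomposition ::
  "('a::topological_space set \<Rightarrow> real) \<Rightarrow> 'a measure \<Rightarrow> 'a measure \<Rightarrow> bool" where
  "jordan_decomposition \<mu> P N \<longleftrightarrow> finite_measure P \<and> finite_measure N \<and>
     sets P = sets borel \<and> sets N = sets borel \<and>
     (\<exists>B\<in>sets borel. emeasure P (- B) = 0 \<and> emeasure N B = 0) \<and>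
     (\<forall>A\<in>sets borel. \<mu> A = measure P A - measure N A)"

text \<open>Jordan decompositions exist and are unique for signed measures, so the following are their two parts.\<close>

definition jordan_pos :: "('a::topological_space set \<Rightarrow> real) \<Rightarrow> 'a measure" where
  "jordan_pos \<mu> = (THE P. \<exists>N. jordan_decomposition \<mu> P N)"

definition jordan_neg :: "('a::topological_space set \<Rightarrow> real) \<Rightarrow> 'a measure" where
  "jordan_neg \<mu> = (THE N. \<exists>P. jordan_decomposition \<mu> P N)"

definition signed_integral :: "('a::topological_space set \<Rightarrow> real) \<Rightarrow> ('a \<Rightarrow> real) \<Rightarrow> real" where
  "signed_integral \<nu> u = (\<integral>z. u z \<partial>jordan_pos \<nu>) - (\<integral>z. u z \<partial>jordan_neg \<nu>)"

definition W_norm :: "real \<Rightarrow> ('k::metric_space set \<Rightarrow> real) \<Rightarrow> ennreal" where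
  "W_norm \<zeta> \<nu> =
     (SUP u\<in>{u. (\<forall>z. \<bar>u z\<bar> \<le> 1) \<and> holder_const \<zeta> u \<le> 1}. ennreal \<bar>signed_integral \<nu> u\<bar>)"

definition AB_space ::
  "'m::topological_space measure \<Rightarrow> (('m \<times> 'k::topological_space) set \<Rightarrow> real) set" where
  "AB_space m = {\<mu>. signed_borel_measure \<mu> \<and>
     absolutely_continuous m (distr (jordan_pos \<mu>) borel fst) \<and>
     absolutely_continuous m (distr (jordan_neg \<mu>) borel fst)}"

definition marginal_density ::
  "'m::topological_space measure \<Rightarrow> ('m \<times> 'k::topological_space) measure \<Rightarrow> 'm \<Rightarrow> real" where
  "marginal_density m \<mu> x = enn2real (RN_deriv m (distr \<mu> borel fst) x)"

text \<open>\<open>\<kappa>\<close> is the family of conditional probabilities in a Rokhlin disintegration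
  of the positive measure \<open>\<mu>\<close> along the leaves \<open>{x} \<times> UNIV\<close>.\<close>

definition rokhlin_disintegration ::
  "'m::topological_space measure \<Rightarrow> ('m \<times> 'k::topological_space) measure \<Rightarrow>
   ('m \<Rightarrow> ('m \<times> 'k) measure) \<Rightarrow> bool" where
  "rokhlin_disintegration m \<mu> \<kappa> \<longleftrightarrow>
     (\<forall>x. prob_space (\<kappa> x) \<and> sets (\<kappa> x) = sets borel \<and> (AE p in \<kappa> x. p \<in> {x} \<times> UNIV)) \<and>
     (\<forall>E\<in>sets borel. (\<lambda>x. emeasure (\<kappa> x) E) \<in> borel_measurable borel \<and>
        emeasure \<mu> E =
          (\<integral>\<^sup>+x. emeasure (\<kappa> x) E \<partial>density m (\<lambda>x. ennreal (marginal_density m \<mu> x))))"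

definition leaf_restriction ::
  "'m::topological_space measure \<Rightarrow> ('m \<times> 'k::topological_space) measure \<Rightarrow>
   ('m \<Rightarrow> ('m \<times> 'k) measure) \<Rightarrow> 'm \<Rightarrow> 'k measure" where
  "leaf_restriction m \<mu> \<kappa> x =
     distr (scale_measure (ennreal (marginal_density m \<mu> x)) (\<kappa> x)) borel snd"

definition signed_leaf_restriction ::
  "'m::topological_space measure \<Rightarrow> (('m \<times> 'k::topological_space) set \<Rightarrow> real) \<Rightarrow>
   ('m \<Rightarrow> ('m \<times> 'k) measure) \<Rightarrow> ('m \<Rightarrow> ('m \<times> 'k) measure) \<Rightarrow> 'm \<Rightarrow> 'k set \<Rightarrow> real" where
  "signed_leaf_restriction m \<mu> \<kappa>p \<kappa>n x A =
     measure (leaf_restriction m (jordan_pos \<mu>) \<kappa>p x) A -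
     measure (leaf_restriction m (jordan_neg \<mu>) \<kappa>n x) A"

text \<open>Rokhlin disintegrations are essentially unique, so the essential supremum below is the same
  for all of them; the infimum merely picks this common value.\<close>

definition L_infty_norm ::
  "real \<Rightarrow> 'm::topological_space measure \<Rightarrow> (('m \<times> 'k::metric_space) set \<Rightarrow> real) \<Rightarrow> ennreal" where
  "L_infty_norm \<zeta> m \<mu> =
     (INF (\<kappa>p, \<kappa>n)\<in>{(\<kappa>p, \<kappa>n). rokhlin_disintegration m (jordan_pos \<mu>) \<kappa>p \<and>
                                rokhlin_disintegration m (jordan_neg \<mu>) \<kappa>n}.
        esssup m (\<lambda>x. W_norm \<zeta> (signed_leaf_restriction m \<mu> \<kappa>p \<kappa>n x)))"

definition L_infty ::
  "real \<Rightarrow> 'm::topological_space measure \<Rightarrow> (('m \<times> 'k::metric_space) set \<Rightarrow> real) set" where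
  "L_infty \<zeta> m = {\<mu>\<in>AB_space m. L_infty_norm \<zeta> m \<mu> < \<infinity>}"

definition S_infty ::
  "real \<Rightarrow> 'm::metric_space measure \<Rightarrow> (('m \<times> 'k::metric_space) set \<Rightarrow> real) set" where
  "S_infty \<zeta> m = {\<mu>\<in>L_infty \<zeta> m. \<exists>h\<in>holder_space \<zeta>. AE x in m.
     marginal_density m (jordan_pos \<mu>) x - marginal_density m (jordan_neg \<mu>) x = h x}"

definition skew_product :: "('m \<Rightarrow> 'm) \<Rightarrow> ('m \<times> 'k \<Rightarrow> 'k) \<Rightarrow> 'm \<times> 'k \<Rightarrow> 'm \<times> 'k" where
  "skew_product f G = (\<lambda>(x, z). (f x, G (x, z)))"

end

theory Submission
  imports Defs
begin

text \<open>Existence: choosing a preimage of each point at random, a point \<open>y\<close> with probability \<open>\<rho> y\<close>, inverts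
  \<open>f\<close> in law, because the transfer operator is dual to \<open>f\<close> and fixes \<open>1\<close>. Along a random backward orbit
  \<open>x, y\<^sub>1, y\<^sub>2, \<dots>\<close> the fibre points \<open>G(y\<^sub>1, G(y\<^sub>2, \<dots> G(y\<^sub>k, z\<^sub>0)))\<close> converge by contraction, and the law of the
  limit, as a function of \<open>x\<close>, is the disintegration of an invariant measure over \<open>m\<^sub>1\<close>.
  Uniqueness: the marginal density \<open>h\<close> of an invariant measure in \<open>S\<^sup>\<infinity>\<close> satisfies \<open>P\<^sub>f h = h\<close> almost
  everywhere, so the spectral gap applied to \<open>h - 1\<close> gives \<open>h = 1\<close>. The contraction of the fibres then
  shows that an invariant measure is determined by its marginal.\<close>

section \<open>The transfer operator of a piecewise injective map\<close>

text \<open>\<open>G\<close> is only measurable in the base variable, so \<open>F\<close> need not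
  be continuous and weak limits of its pushforwards need not be invariant. Composing backwards
  avoids this: new maps enter innermost, where the outer contractions damp their effect, so the
  fibre points converge pointwise. Selecting preimages by independent uniform variables puts all
  backward orbits on one probability space that does not depend on the base point; joint
  measurability and an explicit disintegration then follow from Fubini's theorem. The other obstacle
  is that the known identities hold only almost everywhere, while the transfer operator evaluates
  functions at single points. For densities this is harmless because \<open>f\<close>, having a
  Jacobian, maps null sets to null sets; the contraction is made to hold everywhere by changing
  \<open>G\<close> over a null set of base points.\<close>

definition transfer :: "('m \<Rightarrow> 'm) \<Rightarrow> ('m \<Rightarrow> real) \<Rightarrow> ('m \<Rightarrow> ennreal) \<Rightarrow> 'm \<Rightarrow> ennreal" where
  "transfer f \<rho> \<phi> x = (\<Sum>y\<in>f -` {x}. ennreal (\<rho> y) * \<phi> y)"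

text \<open>The partition has an empty tail, so that disjointness and covering concern one infinite
  sequence. That images of Borel sets are Borel is part of the data; continuous local inverses will
  provide it.\<close>

locale jacobian_system =
  fixes f :: "'m::metric_space \<Rightarrow> 'm" and J :: "'m \<Rightarrow> real" and m :: "'m measure"
    and A :: "nat \<Rightarrow> 'm set" and n :: nat
  assumes invariant: "invariant_borel_prob f m"
    and jacobian: "jacobian_wrt m f J"
    and A_borel [measurable]: "\<And>i. A i \<in> sets borel"
    and A_disjoint: "disjoint_family A"
    and A_cover: "(\<Union>i. A i) = UNIV"
    and A_empty: "\<And>i. n \<le> i \<Longrightarrow> A i = {}"
    and inj_on_A: "\<And>i. inj_on f (A i)"
    and image_borel: "\<And>i B. B \<in> sets borel \<Longrightarrow> B \<subseteq> A i \<Longrightarrow> f ` B \<in> sets borel"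
begin

sublocale prob_space m
  using invariant by (simp add: invariant_borel_prob_def)

lemma sets_m [measurable_cong, simp]: "sets m = sets borel"
  and f_borel [measurable]: "f \<in> borel \<rightarrow>\<^sub>M borel"
  and distr_f: "distr m borel f = m"
  using invariant by (simp_all add: invariant_borel_prob_def)

lemma space_m [simp]: "space m = UNIV"
  using sets_eq_imp_space_eq[OF sets_m] by simp

lemma J_borel [measurable]: "J \<in> borel_measurable borel"
  and J_pos: "0 < J x"
  and emeasure_image: "B \<in> sets borel \<Longrightarrow> inj_on f B \<Longrightarrow>
    emeasure m (f ` B) = (\<integral>\<^sup>+x\<in>B. ennreal (J x) \<partial>m)"
  using jacobian by (simp_all add: jacobian_wrt_def)

definition \<rho> where "\<rho> x = 1 / J x"

lemma \<rho>_borel [measurable]: "\<rho> \<in> borel_measurable borel"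
  unfolding \<rho>_def by measurable

lemma \<rho>_pos: "0 < \<rho> x"
  by (simp add: \<rho>_def J_pos)

lemma image_A [measurable]: "f ` A i \<in> sets borel"
  using image_borel[of "A i" i] by simp

section \<open>Measurable inverse branches\<close>

lemma emeasure_image_subset:
  assumes "B \<in> sets borel" "B \<subseteq> A i"
  shows "emeasure m (f ` B) = (\<integral>\<^sup>+x\<in>B. ennreal (J x) \<partial>m)"
  using assms inj_on_A[of i] by (intro emeasure_image) (auto intro: inj_on_subset)

text \<open>Off the image the inverse is continued by the identity, an arbitrary choice that keeps
  it total and Borel; \<open>weight\<close> vanishes there.\<close>

definition branch where "branch i x = (if x \<in> f ` A i then inv_into (A i) f x else x)"

lemma branch_in: "x \<in> f ` A i \<Longrightarrow> branch i x \<in> A i"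
  by (simp add: branch_def inv_into_into)

lemma f_branch: "x \<in> f ` A i \<Longrightarrow> f (branch i x) = x"
  by (simp add: branch_def f_inv_into_f)

lemma branch_f: "x \<in> A i \<Longrightarrow> branch i (f x) = x"
  by (simp add: branch_def inj_on_A)

lemma vimage_branch: "branch i -` B \<inter> f ` A i = f ` (A i \<inter> B)"
  by (auto simp: branch_f)

lemma branch_borel [measurable]: "branch i \<in> borel \<rightarrow>\<^sub>M borel"
proof (rule measurableI)
  fix B :: "'m set" assume B [measurable]: "B \<in> sets borel"
  have "branch i -` B = f ` (A i \<inter> B) \<union> (B - f ` A i)"
    unfolding vimage_branch[symmetric] by (auto simp: branch_def split: if_splits)
  then show "branch i -` B \<inter> space borel \<in> sets borel"
    using image_borel[of "A i \<inter> B" i] by auto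
qed simp

text \<open>Disjointness of the \<open>A i\<close> keeps the branches through \<open>x\<close>
  distinct, and the cover makes them exhaust the preimages. The range of summation no longer depends
  on \<open>x\<close>, so measurability can be read off.\<close>

lemma sum_preimages:
  fixes \<psi> :: "'m \<Rightarrow> 'b::comm_monoid_add"
  shows "(\<Sum>y\<in>f -` {x}. \<psi> y) = (\<Sum>i<n. if x \<in> f ` A i then \<psi> (branch i x) else 0)"
proof -
  let ?I = "{i\<in>{..<n}. x \<in> f ` A i}"
  have inj: "inj_on (\<lambda>i. branch i x) ?I"
  proof (rule inj_onI, rule ccontr)
    fix i j assume *: "i \<in> ?I" "j \<in> ?I" "branch i x = branch j x" "i \<noteq> j"
    then have "branch i x \<in> A i" "branch i x \<in> A j"
      using branch_in[of x i] branch_in[of x j] by auto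
    moreover have "A i \<inter> A j = {}"
      using A_disjoint \<open>i \<noteq> j\<close> by (rule disjoint_family_onD[OF _ UNIV_I UNIV_I])
    ultimately show False using *(3) by (metis IntI empty_iff)
  qed
  have img: "(\<lambda>i. branch i x) ` ?I = f -` {x}"
  proof (intro equalityI subsetI)
    fix y assume "y \<in> f -` {x}"
    moreover obtain i where i: "y \<in> A i" using A_cover by blast
    moreover have "i < n" using A_empty[of i] i by (metis empty_iff not_le)
    ultimately show "y \<in> (\<lambda>i. branch i x) ` ?I"
      by (intro image_eqI[of _ _ i]) (auto simp: branch_f)
  qed (auto simp: f_branch)
  have "(\<Sum>y\<in>f -` {x}. \<psi> y) = (\<Sum>i\<in>?I. \<psi> (branch i x))"
    unfolding img[symmetric] sum.reindex[OF inj] comp_def ..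
  also have "\<dots> = (\<Sum>i<n. if x \<in> f ` A i then \<psi> (branch i x) else 0)"
    by (rule sum.inter_filter) simp
  finally show ?thesis .
qed

definition weight where "weight i x = (if x \<in> f ` A i then \<rho> (branch i x) else 0)"

lemma weight_borel [measurable]: "weight i \<in> borel_measurable borel"
  unfolding weight_def by measurable

lemma weight_nonneg: "0 \<le> weight i x"
  using \<rho>_pos by (simp add: weight_def less_imp_le)

section \<open>Duality of the transfer operator and \<open>f\<close>\<close>

lemma transfer_eq: "transfer f \<rho> \<phi> x = (\<Sum>i<n. ennreal (weight i x) * \<phi> (branch i x))"
  unfolding transfer_def sum_preimages by (intro sum.cong) (auto simp: weight_def)

lemma transfer_borel [measurable]:
  assumes [measurable]: "\<phi> \<in> borel_measurable borel"
  shows "transfer f \<rho> \<phi> \<in> borel_measurable borel"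
  unfolding transfer_eq by measurable

text \<open>By the Jacobian, the inverse branch carries \<open>m\<close> restricted to the image of
  \<open>A i\<close> to the measure with density \<open>J\<close> on \<open>A i\<close>; the factor
  \<open>\<rho> = 1 / J\<close> cancels \<open>J\<close>.\<close>

lemma nn_integral_branch:
  assumes [measurable]: "\<phi> \<in> borel_measurable borel"
  shows "(\<integral>\<^sup>+x. ennreal (weight i x) * \<phi> (branch i x) \<partial>m) = (\<integral>\<^sup>+x. \<phi> x * indicator (A i) x \<partial>m)"
proof -
  have eq: "distr (density m (indicator (f ` A i))) borel (branch i)
      = density m (\<lambda>x. ennreal (J x) * indicator (A i) x)" (is "?L = ?R")
  proof (rule measure_eqI)
    fix B assume "B \<in> sets ?L"
    then have [measurable]: "B \<in> sets borel" by simp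
    have [measurable]: "branch i -` B \<in> sets borel"
      using measurable_sets[OF branch_borel, of B i] by simp
    have "emeasure ?L B = emeasure (density m (indicator (f ` A i))) (branch i -` B)"
      by (subst emeasure_distr) auto
    also have "\<dots> = (\<integral>\<^sup>+x. indicator (f ` A i \<inter> branch i -` B) x \<partial>m)"
      unfolding indicator_inter_arith by (rule emeasure_density) auto
    also have "\<dots> = emeasure m (f ` (A i \<inter> B))"
      by (subst vimage_branch[symmetric]) (simp add: Int_commute)
    also have "\<dots> = (\<integral>\<^sup>+x. ennreal (J x) * indicator (A i \<inter> B) x \<partial>m)"
      by (rule emeasure_image_subset) auto
    also have "\<dots> = emeasure ?R B"
      unfolding indicator_inter_arith mult.assoc[symmetric]
      by (rule emeasure_density[symmetric]) auto
    finally show "emeasure ?L B = emeasure ?R B" .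
  qed simp
  have "(\<integral>\<^sup>+x. ennreal (weight i x) * \<phi> (branch i x) \<partial>m)
      = (\<integral>\<^sup>+x. indicator (f ` A i) x * (ennreal (\<rho> (branch i x)) * \<phi> (branch i x)) \<partial>m)"
    by (intro nn_integral_cong) (simp add: weight_def)
  also have "\<dots> = (\<integral>\<^sup>+x. ennreal (\<rho> x) * \<phi> x \<partial>?L)"
    by (simp add: nn_integral_distr nn_integral_density)
  also have "\<dots> = (\<integral>\<^sup>+x. ennreal (\<rho> x) * \<phi> x \<partial>?R)"
    unfolding eq ..
  also have "\<dots> = (\<integral>\<^sup>+x. ennreal (J x) * indicator (A i) x * (ennreal (\<rho> x) * \<phi> x) \<partial>m)"
    by (rule nn_integral_density) measurable
  also have "\<dots> = (\<integral>\<^sup>+x. \<phi> x * indicator (A i) x \<partial>m)"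
  proof (rule nn_integral_cong)
    fix x
    have "ennreal (J x) * ennreal (\<rho> x) = 1"
      using J_pos[of x] by (simp add: \<rho>_def less_imp_le flip: ennreal_mult)
    then show "ennreal (J x) * indicator (A i) x * (ennreal (\<rho> x) * \<phi> x) = \<phi> x * indicator (A i) x"
      by (metis mult.assoc mult.commute mult_1)
  qed
  finally show ?thesis .
qed

lemma nn_integral_transfer:
  assumes [measurable]: "\<phi> \<in> borel_measurable borel"
  shows "(\<integral>\<^sup>+x. transfer f \<rho> \<phi> x \<partial>m) = (\<integral>\<^sup>+x. \<phi> x \<partial>m)"
proof -
  have *: "(\<Sum>i<n. \<phi> x * indicator (A i) x) = \<phi> x" for x
  proof -
    obtain i where i: "x \<in> A i" using A_cover by blast
    have "i < n" using A_empty[of i] i by (metis empty_iff not_le)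
    have "disjoint_family_on A {..<n}"
      using A_disjoint by (rule disjoint_family_on_mono[rotated]) simp
    from sum_indicator_disjoint_family[OF this i, of "\<lambda>_. \<phi> x"] \<open>i < n\<close> show ?thesis
      by simp
  qed
  have "(\<integral>\<^sup>+x. transfer f \<rho> \<phi> x \<partial>m) = (\<Sum>i<n. \<integral>\<^sup>+x. \<phi> x * indicator (A i) x \<partial>m)"
    by (simp add: transfer_eq nn_integral_sum nn_integral_branch)
  also have "\<dots> = (\<integral>\<^sup>+x. (\<Sum>i<n. \<phi> x * indicator (A i) x) \<partial>m)"
    by (rule nn_integral_sum[symmetric]) simp
  finally show ?thesis by (simp add: *)
qed

text \<open>A function of \<open>f y\<close> is constant on the fibre over \<open>x\<close> and can
  be pulled out. This turns duality against the constant 1 into duality against all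
  indicators.\<close>

lemma transfer_indicator_vimage:
  "transfer f \<rho> (\<lambda>y. \<phi> y * indicator B (f y)) x = transfer f \<rho> \<phi> x * indicator B x"
  unfolding transfer_def sum_distrib_right by (intro sum.cong) (auto simp: mult.assoc)

lemma density_transfer:
  assumes [measurable]: "\<phi> \<in> borel_measurable borel"
  shows "density m (transfer f \<rho> \<phi>) = distr (density m \<phi>) borel f"
proof (rule measure_eqI)
  fix B assume "B \<in> sets (density m (transfer f \<rho> \<phi>))"
  then have B [measurable]: "B \<in> sets borel" by simp
  have "emeasure (density m (transfer f \<rho> \<phi>)) B
      = (\<integral>\<^sup>+x. transfer f \<rho> (\<lambda>y. \<phi> y * indicator B (f y)) x \<partial>m)"
    unfolding transfer_indicator_vimage by (simp add: emeasure_density)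
  also have "\<dots> = (\<integral>\<^sup>+x. \<phi> x * indicator B (f x) \<partial>m)"
    by (rule nn_integral_transfer) measurable
  also have "\<dots> = emeasure (distr (density m \<phi>) borel f) B"
    using measurable_sets[OF f_borel B]
    by (simp add: emeasure_distr emeasure_density indicator_def)
  finally show "emeasure (density m (transfer f \<rho> \<phi>)) B = emeasure (distr (density m \<phi>) borel f) B" .
qed simp

text \<open>By \<open>density_transfer\<close> both sides are densities of the same measure.\<close>

lemma transfer_invariant:
  assumes [measurable]: "\<phi> \<in> borel_measurable borel"
    and "distr (density m \<phi>) borel f = density m \<phi>"
  shows "AE x in m. transfer f \<rho> \<phi> x = \<phi> x"
  using assms density_transfer[of \<phi>] by (intro density_unique) simp_all

lemma transfer_one: "AE x in m. transfer f \<rho> (\<lambda>_. 1) x = 1"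
  using distr_f by (intro transfer_invariant) (simp_all add: density_1)

lemma sum_weight: "AE x in m. (\<Sum>i<n. weight i x) = 1"
  using transfer_one
proof eventually_elim
  case (elim x)
  then have "ennreal (\<Sum>i<n. weight i x) = 1"
    by (simp add: transfer_eq weight_nonneg)
  then show ?case by (simp only: ennreal_eq_1)
qed

text \<open>\<open>f\<close> maps null sets to null sets: each piece of the image has as its measure
  an integral of \<open>J\<close> over a null set. This allows almost everywhere identities to be
  fed into the operator again.\<close>

lemma AE_preimages:
  assumes "AE y in m. Q y"
  shows "AE x in m. \<forall>y\<in>f -` {x}. Q y"
proof -
  obtain N where "{y\<in>space m. \<not> Q y} \<subseteq> N" "emeasure m N = 0" "N \<in> sets m"
    using assms by (rule AE_E)
  then have N: "N \<in> null_sets m" "{y. \<not> Q y} \<subseteq> N" and [measurable]: "N \<in> sets borel"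
    by (auto intro: null_setsI)
  have "f ` (A i \<inter> N) \<in> null_sets m" for i
  proof -
    have "emeasure m (f ` (A i \<inter> N)) = (\<integral>\<^sup>+x\<in>A i \<inter> N. ennreal (J x) \<partial>m)"
      by (intro emeasure_image_subset[of _ i]) auto
    also have "\<dots> = 0"
      using AE_not_in[OF N(1)] by (subst nn_integral_0_iff_AE) (auto elim!: eventually_mono)
    finally show ?thesis
      using image_borel[of "A i \<inter> N" i] by auto
  qed
  then have "(\<Union>i. f ` (A i \<inter> N)) \<in> null_sets m" by blast
  then have "AE x in m. x \<notin> (\<Union>i. f ` (A i \<inter> N))" by (rule AE_not_in)
  then show ?thesis
  proof eventually_elim
    case (elim x)
    show ?case
    proof (intro ballI, rule ccontr)
      fix y assume "y \<in> f -` {x}" "\<not> Q y"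
      moreover obtain i where "y \<in> A i" using A_cover by blast
      ultimately show False using elim N(2) by auto
    qed
  qed
qed

end

section \<open>Random preimages\<close>

text \<open>Half-open, like the intervals assigned to the branches, which are to tile [0,
  1).\<close>

definition unif :: "real measure" where
  "unif = uniform_measure lborel {0..<1}"

lemma sets_unif [measurable_cong, simp]: "sets unif = sets borel"
  by (simp add: unif_def)

lemma prob_space_unif: "prob_space unif"
  unfolding unif_def by (rule prob_space_uniform_measure) auto

lemma AE_unif: "AE v in unif. 0 \<le> v \<and> v < 1"
  unfolding unif_def by (rule AE_uniform_measureI) auto

lemma nn_integral_unif:
  assumes [measurable]: "\<phi> \<in> borel_measurable borel"
  shows "(\<integral>\<^sup>+v. \<phi> v \<partial>unif) = (\<integral>\<^sup>+v\<in>{0..<1}. \<phi> v \<partial>lborel)"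
  unfolding unif_def by (subst nn_integral_uniform_measure) (auto simp: divide_ennreal_def)

context jacobian_system
begin

section \<open>Selecting a branch by a uniform variable\<close>

definition cum where "cum i x = (\<Sum>j<i. weight j x)"

text \<open>The quantile transform: branch \<open>i\<close> is selected between
  \<open>cum i x\<close> and \<open>cum (Suc i) x\<close>, an interval whose length is its
  weight.\<close>

definition choice where "choice x v = (LEAST i. v < cum (Suc i) x)"

definition preimage where "preimage x v = branch (choice x v) x"

lemma cum_borel [measurable]: "cum i \<in> borel_measurable borel"
  unfolding cum_def by measurable

lemma cum_mono: "i \<le> j \<Longrightarrow> cum i x \<le> cum j x"
  unfolding cum_def by (rule sum_mono2) (auto simp: weight_nonneg)

lemma preimage_borel [measurable]: "(\<lambda>(x, v). preimage x v) \<in> borel \<Otimes>\<^sub>M borel \<rightarrow>\<^sub>M borel"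
  unfolding preimage_def choice_def split_beta
  by (rule measurable_compose_countable) measurable

lemma choice_iff:
  assumes "0 \<le> v" "v < cum n x"
  shows "choice x v = i \<longleftrightarrow> cum i x \<le> v \<and> v < cum (Suc i) x"
proof
  \<comment> \<open>\<open>cum 0 x = 0\<close> excludes \<open>n = 0\<close>; writing
    \<open>n\<close> as a successor supplies the witness that \<open>LEAST\<close> needs.\<close>
  have "n \<noteq> 0" using assms by (cases n) (auto simp: cum_def)
  then have ex: "v < cum (Suc (n - 1)) x" using assms by simp
  assume i: "choice x v = i"
  have "v < cum (Suc i) x"
    using LeastI[of "\<lambda>i. v < cum (Suc i) x", OF ex] i by (simp add: choice_def)
  moreover have "cum i x \<le> v"
  proof (cases i)
    case 0
    then show ?thesis using assms by (simp add: cum_def)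
  next
    case (Suc k)
    then have "k < (LEAST i. v < cum (Suc i) x)" using i by (simp add: choice_def)
    from not_less_Least[OF this] Suc show ?thesis by simp
  qed
  ultimately show "cum i x \<le> v \<and> v < cum (Suc i) x" by simp
next
  assume *: "cum i x \<le> v \<and> v < cum (Suc i) x"
  show "choice x v = i"
    unfolding choice_def
  proof (rule Least_equality)
    fix j assume "v < cum (Suc j) x"
    then show "i \<le> j"
      using * cum_mono[of "Suc j" i x] by (cases "i \<le> j") auto
  qed (use * in simp)
qed

text \<open>If the weights at \<open>x\<close> add up to 1, the selection intervals tile [0, 1),
  each with the length of its weight. The exceptional set is that of \<open>sum_weight\<close>,
  hence common to all \<open>\<phi>\<close>.\<close>

lemma nn_integral_preimage:
  "AE x in m. \<forall>\<phi>\<in>borel_measurable borel. (\<integral>\<^sup>+v. \<phi> (preimage x v) \<partial>unif) = transfer f \<rho> \<phi> x"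
  using sum_weight
proof eventually_elim
  case (elim x)
  then have cum_n: "cum n x = 1" by (simp add: cum_def)
  show ?case
  proof
    fix \<phi> :: "'m \<Rightarrow> ennreal" assume [measurable]: "\<phi> \<in> borel_measurable borel"
    have *: "\<phi> (preimage x v) * indicator {0..<1} v
        = (\<Sum>i<n. \<phi> (branch i x) * indicator {cum i x..<cum (Suc i) x} v)" for v
    proof (cases "0 \<le> v \<and> v < 1")
      case True
      let ?i = "choice x v"
      have iff: "v \<in> {cum i x..<cum (Suc i) x} \<longleftrightarrow> i = ?i" for i
        using choice_iff[of v x i] True cum_n by auto
      have "?i < n"
      proof (rule ccontr)
        assume "\<not> ?i < n"
        then have "cum n x \<le> cum ?i x" by (intro cum_mono) simp
        with iff[of ?i] cum_n True show False by auto
      qed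
      have "(\<Sum>i<n. \<phi> (branch i x) * indicator {cum i x..<cum (Suc i) x} v)
          = (\<Sum>i<n. if i = ?i then \<phi> (branch i x) else 0)"
        by (rule sum.cong) (simp_all only: indicator_def iff, simp_all)
      with \<open>?i < n\<close> True show ?thesis by (simp add: preimage_def)
    next
      case False
      have "v \<notin> {cum i x..<cum (Suc i) x}" if "i < n" for i
        using False cum_n cum_mono[of 0 i x] cum_mono[of "Suc i" n x] that
        by (auto simp: cum_def simp del: sum.lessThan_Suc)
      then have "(\<Sum>i<n. \<phi> (branch i x) * indicator {cum i x..<cum (Suc i) x} v) = 0"
        by (intro sum.neutral) simp
      with False show ?thesis by simp
    qed
    have [measurable]: "preimage x \<in> borel \<rightarrow>\<^sub>M borel"
      using measurable_compose[OF measurable_Pair1' preimage_borel, of x] by simp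
    have "(\<integral>\<^sup>+v. \<phi> (preimage x v) \<partial>unif) = (\<integral>\<^sup>+v\<in>{0..<1}. \<phi> (preimage x v) \<partial>lborel)"
      by (rule nn_integral_unif) measurable
    also have "\<dots> = (\<Sum>i<n. \<phi> (branch i x) * ennreal (cum (Suc i) x - cum i x))"
      unfolding *
      by (subst nn_integral_sum) (simp_all add: nn_integral_cmult_indicator cum_mono)
    also have "\<dots> = transfer f \<rho> \<phi> x"
      by (simp add: transfer_eq cum_def mult.commute)
    finally show "(\<integral>\<^sup>+v. \<phi> (preimage x v) \<partial>unif) = transfer f \<rho> \<phi> x" .
  qed
qed

text \<open>A selected interval is nonempty, so its branch has nonzero weight and hence is a genuine
  inverse at \<open>x\<close>, not the default value of \<open>branch\<close>.\<close>

lemma f_preimage: "AE x in m. AE v in unif. f (preimage x v) = x"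
  using sum_weight
proof eventually_elim
  case (elim x)
  then have cum_n: "cum n x = 1" by (simp add: cum_def)
  show ?case
    using AE_unif
  proof eventually_elim
    case (elim v)
    then have "cum (choice x v) x \<le> v \<and> v < cum (Suc (choice x v)) x"
      using choice_iff[of v x "choice x v"] cum_n by simp
    then have "weight (choice x v) x \<noteq> 0" by (auto simp: cum_def)
    then show ?case by (auto simp: weight_def preimage_def f_branch split: if_splits)
  qed
qed

end

section \<open>The invariant measure of a contracting skew product\<close>

lemma fst_borel [measurable]:
  "fst \<in> (borel :: ('a::topological_space \<times> 'b::topological_space) measure) \<rightarrow>\<^sub>M borel"
  and snd_borel [measurable]:
  "snd \<in> (borel :: ('a \<times> 'b) measure) \<rightarrow>\<^sub>M borel"
  by (intro borel_measurable_continuous_onI continuous_intros)+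

lemma skew_product_borel:
  fixes f :: "'m::second_countable_topology \<Rightarrow> 'm" and G :: "'m \<times> 'k::second_countable_topology \<Rightarrow> 'k"
  assumes "f \<in> borel \<rightarrow>\<^sub>M borel" "G \<in> borel \<rightarrow>\<^sub>M borel"
  shows "skew_product f G \<in> borel \<rightarrow>\<^sub>M borel"
proof -
  have "(\<lambda>p. (f (fst p), G p)) \<in> borel \<rightarrow>\<^sub>M borel"
    using assms fst_borel by (intro borel_measurable_Pair measurable_compose[OF _ assms(1)])
  moreover have "skew_product f G = (\<lambda>p. (f (fst p), G p))"
    by (auto simp: skew_product_def)
  ultimately show ?thesis by simp
qed

text \<open>The contraction is required over every base point, so that backward compositions
  converge everywhere. Second countability identifies the Borel sets of the product with the product
  of the Borel sets.\<close>

locale contracting_skew_system = jacobian_system f J m A n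
  for f :: "'m::{metric_space, second_countable_topology} \<Rightarrow> 'm" and J m A n +
  fixes G :: "'m \<times> 'k::{metric_space, second_countable_topology} \<Rightarrow> 'k" and \<alpha> :: real
  assumes G_borel [measurable]: "G \<in> borel \<rightarrow>\<^sub>M borel"
    and compact_fibre: "compact (UNIV :: 'k set)"
    and \<alpha>: "0 \<le> \<alpha>" "\<alpha> < 1"
    and G_contraction: "\<And>x z1 z2. dist (G (x, z1)) (G (x, z2)) \<le> \<alpha> * dist z1 z2"
begin

abbreviation F where "F \<equiv> skew_product f G"

lemma F_borel [measurable]: "F \<in> borel \<rightarrow>\<^sub>M borel"
  using f_borel G_borel by (rule skew_product_borel)

section \<open>Backward compositions and their pointwise limit\<close>

lemma dist_le_diameter: "dist (z :: 'k) w \<le> diameter (UNIV :: 'k set)"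
  using compact_imp_bounded[OF compact_fibre] by (rule diameter_bounded_bound) auto

text \<open>The first seed selects the preimage whose fibre map is applied last, so increasing
  \<open>k\<close> changes only the innermost argument. The starting point \<open>undefined\<close>
  is arbitrary and does not affect the limit.\<close>

fun approx :: "nat \<Rightarrow> 'm \<Rightarrow> real stream \<Rightarrow> 'k" where
  "approx 0 x \<omega> = undefined"
| "approx (Suc k) x \<omega> =
    G (preimage x (shd \<omega>), approx k (preimage x (shd \<omega>)) (stl \<omega>))"

definition fibre where "fibre x \<omega> = lim (\<lambda>k. approx k x \<omega>)"

text \<open>The two compositions share their \<open>k\<close> outer maps, each contracting by
  \<alpha>. Base point and seeds are generalised because the recursion moves both.\<close>

lemma dist_approx:
  "dist (approx k x \<omega>) (approx (k + j) x \<omega>) \<le> \<alpha> ^ k * diameter (UNIV :: 'k set)"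
proof (induction k arbitrary: x \<omega>)
  case 0
  then show ?case by (simp add: dist_le_diameter)
next
  case (Suc k)
  let ?y = "preimage x (shd \<omega>)"
  have "dist (approx (Suc k) x \<omega>) (approx (Suc k + j) x \<omega>)
      \<le> \<alpha> * dist (approx k ?y (stl \<omega>)) (approx (k + j) ?y (stl \<omega>))"
    using G_contraction by simp
  also have "\<dots> \<le> \<alpha> * (\<alpha> ^ k * diameter (UNIV :: 'k set))"
    by (rule mult_left_mono[OF Suc.IH \<alpha>(1)])
  finally show ?case by (simp add: mult.assoc)
qed

lemma contraction_null: "(\<lambda>k. \<alpha> ^ k * d) \<longlonglongrightarrow> 0"
  using \<alpha> by (intro tendsto_mult_left_zero LIMSEQ_power_zero) simp

lemma approx_tendsto: "(\<lambda>k. approx k x \<omega>) \<longlonglongrightarrow> fibre x \<omega>"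
proof -
  have "Cauchy (\<lambda>k. approx k x \<omega>)"
  proof (rule metric_CauchyI)
    fix e :: real assume "e > 0"
    then obtain M where M: "\<And>k. k \<ge> M \<Longrightarrow> \<alpha> ^ k * diameter (UNIV :: 'k set) < e"
      using order_tendstoD(2)[OF contraction_null, of e "diameter (UNIV :: 'k set)"]
      by (auto simp: eventually_sequentially)
    have less: "dist (approx k x \<omega>) (approx l x \<omega>) < e" if "k \<ge> M" "k \<le> l" for k l
      using dist_approx[of k x \<omega> "l - k"] M[OF that(1)] that(2) by simp
    have "\<forall>k\<ge>M. \<forall>l\<ge>M. dist (approx k x \<omega>) (approx l x \<omega>) < e"
      using less by (metis dist_commute nat_le_linear)
    then show "\<exists>M. \<forall>k\<ge>M. \<forall>l\<ge>M. dist (approx k x \<omega>) (approx l x \<omega>) < e" ..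
  qed
  then have "convergent (\<lambda>k. approx k x \<omega>)"
    using compact_imp_complete[OF compact_fibre] unfolding complete_def convergent_def by blast
  then show ?thesis by (simp add: fibre_def convergent_LIMSEQ_iff)
qed

text \<open>The recursion passes to the limit because \<open>G\<close> is Lipschitz in the fibre
  variable, while the base point stays at \<open>preimage x (shd \<omega>)\<close>
  throughout.\<close>

lemma fibre_unfold:
  "fibre x \<omega> = G (preimage x (shd \<omega>), fibre (preimage x (shd \<omega>)) (stl \<omega>))"
proof (rule LIMSEQ_unique)
  let ?y = "preimage x (shd \<omega>)"
  show "(\<lambda>k. approx (Suc k) x \<omega>) \<longlonglongrightarrow> fibre x \<omega>"
    by (rule LIMSEQ_Suc[OF approx_tendsto[of x \<omega>]])
  have "(\<lambda>k. dist (approx k ?y (stl \<omega>)) (fibre ?y (stl \<omega>))) \<longlonglongrightarrow> 0"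
    using approx_tendsto[of ?y "stl \<omega>"] by (simp only: tendsto_dist_iff[symmetric])
  then have "(\<lambda>k. \<alpha> * dist (approx k ?y (stl \<omega>)) (fibre ?y (stl \<omega>))) \<longlonglongrightarrow> 0"
    by (rule tendsto_mult_right_zero)
  then have "(\<lambda>k. dist (approx (Suc k) x \<omega>) (G (?y, fibre ?y (stl \<omega>)))) \<longlonglongrightarrow> 0"
    by (rule Lim_null_comparison[rotated]) (simp add: G_contraction)
  then show "(\<lambda>k. approx (Suc k) x \<omega>) \<longlonglongrightarrow> G (?y, fibre ?y (stl \<omega>))"
    by (simp only: tendsto_dist_iff[symmetric])
qed

section \<open>The law of the limit and its invariance\<close>

abbreviation S where "S \<equiv> stream_space unif"

sublocale U: prob_space unif
  by (rule prob_space_unif)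

sublocale S: prob_space S
  by (rule U.prob_space_stream_space)

lemma space_S [simp]: "space S = UNIV"
  using sets_eq_imp_space_eq[OF sets_unif] by (simp add: space_stream_space)

lemma approx_borel [measurable]: "(\<lambda>(x, \<omega>). approx k x \<omega>) \<in> borel \<Otimes>\<^sub>M S \<rightarrow>\<^sub>M borel"
proof (induction k)
  case (Suc k)
  have G': "G \<in> borel \<Otimes>\<^sub>M borel \<rightarrow>\<^sub>M borel" using G_borel by (simp add: borel_prod)
  have [measurable]: "(\<lambda>p. preimage (fst p) (shd (snd p))) \<in> borel \<Otimes>\<^sub>M S \<rightarrow>\<^sub>M borel"
    using measurable_compose[OF _ preimage_borel, of "\<lambda>p. (fst p, shd (snd p))" "borel \<Otimes>\<^sub>M S"]
    by simp
  have "(\<lambda>p. approx k (preimage (fst p) (shd (snd p))) (stl (snd p))) \<in> borel \<Otimes>\<^sub>M S \<rightarrow>\<^sub>M borel"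
    using measurable_compose[OF _ Suc, of "\<lambda>p. (preimage (fst p) (shd (snd p)), stl (snd p))" "borel \<Otimes>\<^sub>M S"]
    by simp
  then show ?case
    unfolding approx.simps split_beta by (intro measurable_compose[OF measurable_Pair G']) auto
qed simp

lemma fibre_borel [measurable]: "(\<lambda>(x, \<omega>). fibre x \<omega>) \<in> borel \<Otimes>\<^sub>M S \<rightarrow>\<^sub>M borel"
  by (rule borel_measurable_LIMSEQ_metric[where f = "\<lambda>k (x, \<omega>). approx k x \<omega>"])
    (auto simp: approx_tendsto)

lemma pair_fibre_borel [measurable]:
  "(\<lambda>(x, \<omega>). (x, fibre x \<omega>)) \<in> borel \<Otimes>\<^sub>M S \<rightarrow>\<^sub>M borel"
  unfolding borel_prod[symmetric] by measurable

lemma fibre_section [measurable]: "(\<lambda>\<omega>. (x, fibre x \<omega>)) \<in> S \<rightarrow>\<^sub>M borel"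
  using measurable_compose[OF measurable_Pair1' pair_fibre_borel, of x] by simp

text \<open>The law of the limit point over the fixed base point \<open>x\<close>, later the
  conditional measure of the Rokhlin disintegration.\<close>

definition kernel where "kernel x = distr S borel (\<lambda>\<omega>. (x, fibre x \<omega>))"

definition limit_measure where
  "limit_measure = distr (m \<Otimes>\<^sub>M S) borel (\<lambda>(x, \<omega>). (x, fibre x \<omega>))"

lemma nn_integral_kernel:
  assumes [measurable]: "\<phi> \<in> borel_measurable borel"
  shows "(\<integral>\<^sup>+p. \<phi> p \<partial>kernel x) = (\<integral>\<^sup>+\<omega>. \<phi> (x, fibre x \<omega>) \<partial>S)"
  unfolding kernel_def by (rule nn_integral_distr) measurable

lemma kernel_measurable [measurable]:
  assumes [measurable]: "\<phi> \<in> borel_measurable borel"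
  shows "(\<lambda>x. \<integral>\<^sup>+p. \<phi> p \<partial>kernel x) \<in> borel_measurable borel"
proof -
  have "(\<lambda>(x, \<omega>). \<phi> (x, fibre x \<omega>)) \<in> borel_measurable (borel \<Otimes>\<^sub>M S)"
    using measurable_compose[OF pair_fibre_borel assms] by (simp add: split_beta)
  then show ?thesis
    unfolding nn_integral_kernel[OF assms] by (rule S.borel_measurable_nn_integral)
qed

lemma nn_integral_limit_measure:
  assumes [measurable]: "\<phi> \<in> borel_measurable borel"
  shows "(\<integral>\<^sup>+p. \<phi> p \<partial>limit_measure) = (\<integral>\<^sup>+x. \<integral>\<^sup>+p. \<phi> p \<partial>kernel x \<partial>m)"
proof -
  have [measurable]: "(\<lambda>p. \<phi> (fst p, fibre (fst p) (snd p))) \<in> borel_measurable (m \<Otimes>\<^sub>M S)"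
    using measurable_compose[OF pair_fibre_borel assms] by (simp add: split_beta)
  have "(\<integral>\<^sup>+p. \<phi> p \<partial>limit_measure) = (\<integral>\<^sup>+p. \<phi> (fst p, fibre (fst p) (snd p)) \<partial>(m \<Otimes>\<^sub>M S))"
    unfolding limit_measure_def by (subst nn_integral_distr) (simp_all add: split_beta)
  also have "\<dots> = (\<integral>\<^sup>+x. \<integral>\<^sup>+p. \<phi> p \<partial>kernel x \<partial>m)"
    by (subst S.nn_integral_fst[symmetric]) (simp_all add: nn_integral_kernel)
  finally show ?thesis .
qed

text \<open>The first seed is independent of the rest. Splitting it off writes the limit point over
  \<open>x\<close> as the \<open>F\<close>-image of a limit point over a random preimage with fresh
  seeds; averaging over that preimage is the transfer operator.\<close>

lemma nn_integral_kernel_transfer: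
  assumes [measurable]: "\<phi> \<in> borel_measurable borel"
  shows "AE x in m. (\<integral>\<^sup>+p. \<phi> p \<partial>kernel x) = transfer f \<rho> (\<lambda>y. \<integral>\<^sup>+p. \<phi> (F p) \<partial>kernel y) x"
  using nn_integral_preimage f_preimage
proof eventually_elim
  case (elim x)
  let ?H = "\<lambda>y. \<integral>\<^sup>+p. \<phi> (F p) \<partial>kernel y"
  have "(\<integral>\<^sup>+p. \<phi> p \<partial>kernel x) = (\<integral>\<^sup>+v. \<integral>\<^sup>+\<omega>. \<phi> (x, fibre x (v ## \<omega>)) \<partial>S \<partial>unif)"
    by (simp add: nn_integral_kernel U.nn_integral_stream_space)
  also have "\<dots> = (\<integral>\<^sup>+v. ?H (preimage x v) \<partial>unif)"
  proof (rule nn_integral_cong_AE)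
    show "AE v in unif. (\<integral>\<^sup>+\<omega>. \<phi> (x, fibre x (v ## \<omega>)) \<partial>S) = ?H (preimage x v)"
      using elim(2)
    proof eventually_elim
      case (elim v)
      \<comment> \<open>\<open>f_preimage\<close> matches the base coordinates,
        \<open>fibre_unfold\<close> the fibre coordinates.\<close>
      then have "(x, fibre x (v ## \<omega>)) = F (preimage x v, fibre (preimage x v) \<omega>)" for \<omega>
        by (subst fibre_unfold) (simp add: skew_product_def)
      then show ?case by (simp add: nn_integral_kernel)
    qed
  qed
  also have "\<dots> = transfer f \<rho> ?H x"
    using elim(1) by (rule bspec) measurable
  finally show ?case .
qed

text \<open>Integrating \<open>nn_integral_kernel_transfer\<close> over \<open>m\<close> removes the
  operator, because it preserves integrals.\<close>

lemma limit_measure_invariant: "invariant_borel_prob F limit_measure"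
proof -
  interpret MS: pair_prob_space m S ..
  have "distr limit_measure borel F = limit_measure"
  proof (rule measure_eqI)
    fix E assume "E \<in> sets (distr limit_measure borel F)"
    then have [measurable]: "E \<in> sets borel" by simp
    let ?H = "\<lambda>y. \<integral>\<^sup>+p. indicator E (F p) \<partial>kernel y"
    have "emeasure limit_measure E = (\<integral>\<^sup>+x. \<integral>\<^sup>+p. indicator E p \<partial>kernel x \<partial>m)"
      by (subst nn_integral_limit_measure[symmetric]) (simp_all add: limit_measure_def)
    also have "\<dots> = (\<integral>\<^sup>+x. transfer f \<rho> ?H x \<partial>m)"
      by (rule nn_integral_cong_AE) (rule nn_integral_kernel_transfer, measurable)
    also have "\<dots> = (\<integral>\<^sup>+y. ?H y \<partial>m)"
      by (rule nn_integral_transfer) measurable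
    also have "\<dots> = (\<integral>\<^sup>+p. indicator E (F p) \<partial>limit_measure)"
      by (rule nn_integral_limit_measure[symmetric]) measurable
    also have "\<dots> = (\<integral>\<^sup>+p. indicator E p \<partial>distr limit_measure borel F)"
      by (rule nn_integral_distr[symmetric]) (simp_all add: limit_measure_def)
    also have "\<dots> = emeasure (distr limit_measure borel F) E"
      by simp
    finally show "emeasure (distr limit_measure borel F) E = emeasure limit_measure E" ..
  qed (simp add: limit_measure_def)
  moreover have "prob_space limit_measure"
    unfolding limit_measure_def by (rule MS.prob_space_distr) measurable
  ultimately show ?thesis
    by (simp add: invariant_borel_prob_def limit_measure_def)
qed

lemma limit_measure_marginal: "distr limit_measure borel fst = m"
proof (rule measure_eqI)
  fix B assume "B \<in> sets (distr limit_measure borel fst)"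
  then have [measurable]: "B \<in> sets borel" by simp
  have "emeasure (distr limit_measure borel fst) B = (\<integral>\<^sup>+p. indicator B p \<partial>distr limit_measure borel fst)"
    by simp
  also have "\<dots> = (\<integral>\<^sup>+p. indicator B (fst p) \<partial>limit_measure)"
    by (rule nn_integral_distr) (simp_all add: limit_measure_def)
  also have "\<dots> = (\<integral>\<^sup>+x. indicator B x \<partial>m)"
    by (simp add: nn_integral_limit_measure nn_integral_kernel S.emeasure_space_1[simplified])
  finally show "emeasure (distr limit_measure borel fst) B = emeasure m B" by simp
qed simp

lemma emeasure_limit_measure:
  assumes [measurable]: "E \<in> sets borel"
  shows "(\<lambda>x. emeasure (kernel x) E) \<in> borel_measurable borel"
    and "emeasure limit_measure E = (\<integral>\<^sup>+x. emeasure (kernel x) E \<partial>m)"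
proof -
  have *: "emeasure (kernel x) E = (\<integral>\<^sup>+p. indicator E p \<partial>kernel x)" for x
    by (simp add: kernel_def)
  show "(\<lambda>x. emeasure (kernel x) E) \<in> borel_measurable borel"
    unfolding * by measurable
  show "emeasure limit_measure E = (\<integral>\<^sup>+x. emeasure (kernel x) E \<partial>m)"
    unfolding * by (subst nn_integral_limit_measure[symmetric]) (simp_all add: limit_measure_def)
qed

lemma prob_space_kernel: "prob_space (kernel x)"
  unfolding kernel_def by (rule S.prob_space_distr) measurable

lemma kernel_concentrated: "AE p in kernel x. p \<in> {x} \<times> UNIV"
proof -
  have "{p. fst p = x} \<in> sets (borel :: ('m \<times> 'k) measure)"
    by (intro borel_closed closed_Collect_eq continuous_intros)
  then show ?thesis
    unfolding kernel_def by (subst AE_distr_iff) (auto simp: mem_Times_iff)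
qed

end

section \<open>Invariant measures with the same marginal\<close>

lemma lipschitz_bump:
  fixes E :: "'a::metric_space set"
  defines "u \<equiv> \<lambda>k p. max 0 (1 - real k * infdist p E)"
  shows "\<bar>u k p - u k q\<bar> \<le> real k * dist p q"
proof -
  have "\<bar>u k p - u k q\<bar> \<le> \<bar>real k * infdist p E - real k * infdist q E\<bar>"
    unfolding u_def by (auto simp: max_def abs_if)
  also have "\<dots> = real k * \<bar>infdist p E - infdist q E\<bar>"
    by (simp add: abs_mult flip: right_diff_distrib)
  also have "\<dots> \<le> real k * dist p q"
    by (intro mult_left_mono infdist_triangle_abs) simp
  finally show ?thesis .
qed

text \<open>Truncations of the distance to a closed set are Lipschitz and decrease to its indicator,
  and the closed sets form an intersection-stable generator.\<close>

lemma measure_eqI_lipschitz: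
  fixes \<mu> \<nu> :: "'a::metric_space measure"
  assumes "finite_measure \<mu>" "finite_measure \<nu>" and sets: "sets \<mu> = sets borel" "sets \<nu> = sets borel"
    and eq: "\<And>u k. \<lbrakk>\<And>p. 0 \<le> u p \<and> u p \<le> 1; \<And>p q. \<bar>u p - u q\<bar> \<le> real k * dist p q\<rbrakk>
      \<Longrightarrow> (\<integral>p. u p \<partial>\<mu>) = (\<integral>p. u p \<partial>\<nu>)"
  shows "\<mu> = \<nu>"
proof -
  interpret \<mu>: finite_measure \<mu> by fact
  interpret \<nu>: finite_measure \<nu> by fact
  have closed_eq: "emeasure \<mu> E = emeasure \<nu> E" if E: "closed E" for E
  \<comment> \<open>\<open>infdist p {}\<close> is 0 by convention, so for the empty set the bumps
    would not converge to the indicator.\<close>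
  proof (cases "E = {}")
    case False
    define u where "u k p = max 0 (1 - real k * infdist p E)" for k p
    have u_lim: "(\<lambda>k. u k p) \<longlonglongrightarrow> indicator E p" for p
    proof (cases "p \<in> E")
      case True
      then show ?thesis by (simp add: u_def)
    next
      case False
      then have pos: "infdist p E > 0"
        using in_closed_iff_infdist_zero[OF E \<open>E \<noteq> {}\<close>] infdist_nonneg[of p E] by force
      then obtain M :: nat where M: "1 < real M * infdist p E"
        using reals_Archimedean3 by blast
      have "u k p = 0" if "k \<ge> M" for k
      proof -
        have "real M * infdist p E \<le> real k * infdist p E"
          using that pos by (intro mult_right_mono) auto
        with M show ?thesis by (simp add: u_def)
      qed
      then have "eventually (\<lambda>k. u k p = 0) sequentially"
        by (auto simp: eventually_sequentially)
      then show ?thesis using False by (simp add: tendsto_eventually)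
    qed
    have u_cont [measurable]: "u k \<in> borel_measurable borel" for k
      unfolding u_def by (intro borel_measurable_continuous_onI continuous_intros)
    have u_bound: "0 \<le> u k p \<and> u k p \<le> 1" for k p
      by (simp add: u_def infdist_nonneg)
    have lim: "(\<lambda>k. \<integral>p. u k p \<partial>M) \<longlonglongrightarrow> measure M E" if "finite_measure M" "sets M = sets borel" for M
    proof -
      interpret finite_measure M by fact
      have [measurable_cong]: "sets M = sets borel" by fact
      have [measurable]: "E \<in> sets borel" using E by simp
      have "(\<lambda>k. \<integral>p. u k p \<partial>M) \<longlonglongrightarrow> (\<integral>p. indicator E p \<partial>M)"
        by (rule integral_dominated_convergence[where w="\<lambda>_. 1"]) (auto simp: u_lim u_bound)
      then show ?thesis using that sets_eq_imp_space_eq[OF that(2)] by simp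
    qed
    have "(\<integral>p. u k p \<partial>\<mu>) = (\<integral>p. u k p \<partial>\<nu>)" for k
      using u_bound lipschitz_bump[of k _ E] by (intro eq[of _ k]) (simp_all add: u_def)
    then have "measure \<mu> E = measure \<nu> E"
      using LIMSEQ_unique[OF lim[OF assms(1) sets(1)]] lim[OF assms(2) sets(2)] by simp
    then show ?thesis by (simp add: \<mu>.emeasure_eq_measure \<nu>.emeasure_eq_measure)
  qed simp
  show ?thesis
  proof (rule measure_eqI_generator_eq[where E="Collect closed" and \<Omega>=UNIV and A="\<lambda>_. UNIV"])
    show "sets \<mu> = sigma_sets UNIV (Collect closed)" "sets \<nu> = sigma_sets UNIV (Collect closed)"
      unfolding sets borel_eq_closed by (simp_all add: sets_measure_of)
  qed (use closed_eq \<mu>.emeasure_finite in \<open>auto simp: Int_stable_def\<close>)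
qed

context contracting_skew_system
begin

section \<open>Forward contraction along the leaves\<close>

lemma iterate_fst: "fst ((F ^^ k) (x, z)) = (f ^^ k) x"
  by (induction k) (auto simp: skew_product_def split_beta)

text \<open>The two orbits start on one leaf and so stay on common leaves, where the product
  distance is the distance of the fibre coordinates.\<close>

lemma iterate_contraction:
  "dist ((F ^^ k) (x, z)) ((F ^^ k) (x, w)) \<le> \<alpha> ^ k * diameter (UNIV :: 'k set)"
proof (induction k)
  case 0
  then show ?case by (simp add: dist_Pair_Pair dist_le_diameter)
next
  case (Suc k)
  let ?p = "(F ^^ k) (x, z)" and ?q = "(F ^^ k) (x, w)"
  have "fst ?p = fst ?q" by (simp add: iterate_fst)
  then obtain y a b where *: "?p = (y, a)" "?q = (y, b)" by (metis prod.collapse)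
  have "dist ((F ^^ Suc k) (x, z)) ((F ^^ Suc k) (x, w)) = dist (G (y, a)) (G (y, b))"
    by (simp only: funpow.simps comp_apply *) (simp add: skew_product_def dist_Pair_Pair)
  also have "\<dots> \<le> \<alpha> * dist a b" by (rule G_contraction)
  also have "dist a b = dist ?p ?q" by (simp add: * dist_Pair_Pair)
  also have "\<alpha> * dist ?p ?q \<le> \<alpha> * (\<alpha> ^ k * diameter (UNIV :: 'k set))"
    by (rule mult_left_mono[OF Suc.IH \<alpha>(1)])
  finally show ?case by (simp add: mult.assoc)
qed

text \<open>By the contraction, \<open>\<integral>u \<partial>\<mu> = \<integral>u \<circ> F\<^sup>k \<partial>\<mu>\<close> is asymptotically a function of the marginal of \<open>\<mu>\<close>.\<close>

lemma integral_tendsto_marginal: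
  assumes \<mu>: "invariant_borel_prob F \<mu>" "distr \<mu> borel fst = m"
    and u: "\<And>p. 0 \<le> u p \<and> u p \<le> 1" "\<And>p q. \<bar>u p - u q\<bar> \<le> real l * dist p q"
  shows "(\<lambda>k. \<integral>x. u ((F ^^ k) (x, undefined)) \<partial>m) \<longlonglongrightarrow> (\<integral>p. u p \<partial>\<mu>)"
proof -
  interpret \<mu>: prob_space \<mu> using \<mu>(1) by (simp add: invariant_borel_prob_def)
  have [measurable_cong]: "sets \<mu> = sets borel" and inv: "distr \<mu> borel F = \<mu>"
    using \<mu>(1) by (simp_all add: invariant_borel_prob_def)
  have "(real l)-lipschitz_on UNIV u"
    using u(2) by (intro lipschitz_onI) (auto simp: dist_real_def)
  then have [measurable]: "u \<in> borel_measurable borel"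
    by (intro borel_measurable_continuous_onI lipschitz_on_continuous_on)
  have Fk [measurable]: "(F ^^ k) \<in> borel \<rightarrow>\<^sub>M borel" for k
  proof (induction k)
    case (Suc k)
    then show ?case unfolding funpow.simps by (rule measurable_comp[OF _ F_borel])
  qed (simp add: id_def)
  have inv_k: "distr \<mu> borel (F ^^ k) = \<mu>" for k
  proof (induction k)
    case 0
    then show ?case using \<mu>(1) by (simp add: distr_id2 invariant_borel_prob_def id_def)
  next
    case (Suc k)
    have "distr \<mu> borel (F ^^ Suc k) = distr (distr \<mu> borel (F ^^ k)) borel F"
      unfolding funpow.simps by (rule distr_distr[symmetric]) measurable
    then show ?case using Suc inv by (simp only:)
  qed
  have sec [measurable]: "(\<lambda>x. (x, undefined)) \<in> borel \<rightarrow>\<^sub>M (borel :: ('m \<times> 'k) measure)"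
    by (intro borel_measurable_continuous_onI continuous_intros)
  \<comment> \<open>Freezing the fibre coordinate at an arbitrary point leaves a function of the
    base coordinate, whose integral depends on \<open>\<mu>\<close> only through its
    marginal.\<close>
  define v where "v k p = u ((F ^^ k) (fst p, undefined))" for k and p :: "'m \<times> 'k"
  have [measurable]: "v k \<in> borel_measurable borel" for k
    unfolding v_def by measurable
  have "\<bar>u p\<bar> \<le> 1" for p
    using u(1)[of p] by simp
  then have int_comp: "integrable \<mu> (\<lambda>p. u (h p))" if [measurable]: "h \<in> borel \<rightarrow>\<^sub>M borel" for h
    by (intro \<mu>.integrable_const_bound[where B=1]) simp_all
  have int: "integrable \<mu> (\<lambda>p. u ((F ^^ k) p))" "integrable \<mu> (v k)" for k
    unfolding v_def by (rule int_comp, measurable)+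
  have "\<bar>(\<integral>x. u ((F ^^ k) (x, undefined)) \<partial>m) - (\<integral>p. u p \<partial>\<mu>)\<bar>
      \<le> real l * (\<alpha> ^ k * diameter (UNIV :: 'k set))" for k
  proof -
    have "(\<integral>x. u ((F ^^ k) (x, undefined)) \<partial>m) = (\<integral>p. v k p \<partial>\<mu>)"
      unfolding \<mu>(2)[symmetric] by (subst integral_distr) (simp_all add: v_def[abs_def])
    moreover have "(\<integral>p. u p \<partial>\<mu>) = (\<integral>p. u ((F ^^ k) p) \<partial>\<mu>)"
      by (subst inv_k[of k, symmetric], subst integral_distr) simp_all
    ultimately have "\<bar>(\<integral>x. u ((F ^^ k) (x, undefined)) \<partial>m) - (\<integral>p. u p \<partial>\<mu>)\<bar>
        = \<bar>\<integral>p. v k p - u ((F ^^ k) p) \<partial>\<mu>\<bar>"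
      using int by simp
    also have "\<dots> \<le> (\<integral>p. \<bar>v k p - u ((F ^^ k) p)\<bar> \<partial>\<mu>)"
      by (rule integral_abs_bound)
    also have "\<dots> \<le> (\<integral>p. real l * (\<alpha> ^ k * diameter (UNIV :: 'k set)) \<partial>\<mu>)"
    proof (rule integral_mono)
      fix p :: "'m \<times> 'k"
      have "\<bar>v k p - u ((F ^^ k) p)\<bar> \<le> real l * dist ((F ^^ k) (fst p, undefined)) ((F ^^ k) (fst p, snd p))"
        unfolding v_def prod.collapse by (rule u(2))
      also have "\<dots> \<le> real l * (\<alpha> ^ k * diameter (UNIV :: 'k set))"
        by (intro mult_left_mono iterate_contraction) simp
      finally show "\<bar>v k p - u ((F ^^ k) p)\<bar> \<le> real l * (\<alpha> ^ k * diameter (UNIV :: 'k set))" .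
    qed (use int in auto)
    finally show ?thesis by (simp add: \<mu>.prob_space)
  qed
  then have "\<forall>\<^sub>F k in sequentially. norm ((\<integral>x. u ((F ^^ k) (x, undefined)) \<partial>m) - (\<integral>p. u p \<partial>\<mu>))
      \<le> real l * (\<alpha> ^ k * diameter (UNIV :: 'k set))"
    by simp
  moreover have "(\<lambda>k. real l * (\<alpha> ^ k * diameter (UNIV :: 'k set))) \<longlonglongrightarrow> 0"
    by (rule tendsto_mult_right_zero[OF contraction_null])
  ultimately have "(\<lambda>k. (\<integral>x. u ((F ^^ k) (x, undefined)) \<partial>m) - (\<integral>p. u p \<partial>\<mu>)) \<longlonglongrightarrow> 0"
    by (rule Lim_null_comparison)
  then show ?thesis by (simp add: LIM_zero_iff)
qed

text \<open>The integrals of a Lipschitz function are limits of one sequence that involves only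
  \<open>m\<close>.\<close>

lemma invariant_unique:
  assumes "invariant_borel_prob F \<mu>" "distr \<mu> borel fst = m"
    and "invariant_borel_prob F \<nu>" "distr \<nu> borel fst = m"
  shows "\<mu> = \<nu>"
proof (rule measure_eqI_lipschitz)
  fix u :: "'m \<times> 'k \<Rightarrow> real" and k :: nat
  assume u: "\<And>p. 0 \<le> u p \<and> u p \<le> 1" "\<And>p q. \<bar>u p - u q\<bar> \<le> real k * dist p q"
  show "(\<integral>p. u p \<partial>\<mu>) = (\<integral>p. u p \<partial>\<nu>)"
    using integral_tendsto_marginal[OF assms(1,2) u] integral_tendsto_marginal[OF assms(3,4) u]
    by (rule LIMSEQ_unique)
qed (use assms in \<open>auto simp: invariant_borel_prob_def prob_space_def\<close>)

end

section \<open>Jordan decompositions and leaf restrictions\<close>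

text \<open>If \<open>P\<close> lives on \<open>B\<close> and \<open>N\<close> vanishes there, then
  \<open>P A = \<mu> (A \<inter> B) \<le> P' (A \<inter> B) \<le> P' A\<close>; symmetry gives
  equality. This gives the \<open>THE\<close> in \<open>jordan_pos\<close> and
  \<open>jordan_neg\<close> its meaning.\<close>

lemma jordan_decomposition_unique:
  assumes "jordan_decomposition \<mu> P N" "jordan_decomposition \<mu> P' N'"
  shows "P = P'" "N = N'"
proof -
  have le: "emeasure P A \<le> emeasure P' A"
    if PN: "jordan_decomposition \<mu> P N" "jordan_decomposition \<mu> P' N'" and A: "A \<in> sets borel"
    for P N P' N' A
  proof -
    interpret P: finite_measure P using PN by (simp add: jordan_decomposition_def)
    interpret N: finite_measure N using PN by (simp add: jordan_decomposition_def)
    interpret P': finite_measure P' using PN by (simp add: jordan_decomposition_def)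
    have sets: "sets P = sets borel" "sets N = sets borel" "sets P' = sets borel"
      using PN by (simp_all add: jordan_decomposition_def)
    obtain B where B: "B \<in> sets borel" "emeasure P (- B) = 0" "emeasure N B = 0"
      using PN(1) by (auto simp: jordan_decomposition_def)
    have AB: "A \<inter> B \<in> sets borel" using A B by auto
    have "measure N (A \<inter> B) = 0"
      using emeasure_mono[of "A \<inter> B" B N] B sets by (simp add: measure_def)
    then have "measure P (A \<inter> B) = \<mu> (A \<inter> B)"
      using PN(1) AB by (simp add: jordan_decomposition_def)
    also have "\<dots> \<le> measure P' (A \<inter> B)"
      using PN(2) AB by (simp add: jordan_decomposition_def)
    also have "\<dots> \<le> measure P' A"
      using A sets by (intro P'.finite_measure_mono) auto
    finally have le: "emeasure P (A \<inter> B) \<le> emeasure P' A"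
      by (simp add: P.emeasure_eq_measure P'.emeasure_eq_measure)
    have "- B \<in> null_sets P" using B sets by auto
    then have "emeasure P (A - - B) = emeasure P A"
      using A sets by (intro emeasure_Diff_null_set) auto
    with le show ?thesis by (simp add: Diff_eq)
  qed
  have sets: "sets P = sets borel" "sets P' = sets borel" "sets N = sets borel" "sets N' = sets borel"
    using assms by (simp_all add: jordan_decomposition_def)
  show PP: "P = P'"
    using le[OF assms] le[OF assms(2,1)] sets by (intro measure_eqI antisym) auto
  have "finite_measure N" "finite_measure N'" and
    "measure N A = measure N' A" if "A \<in> sets borel" for A
    using assms that by (auto simp: jordan_decomposition_def PP)
  then show "N = N'"
    using sets by (intro measure_eqI) (auto simp: finite_measure.emeasure_eq_measure)
qed

lemma jordan_pos_neg:
  assumes "jordan_decomposition \<mu> P N"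
  shows "jordan_pos \<mu> = P" "jordan_neg \<mu> = N"
  unfolding jordan_pos_def jordan_neg_def
  using assms by (blast intro: the_equality jordan_decomposition_unique)+

lemma jordan_decomposition_measure:
  assumes "finite_measure \<mu>" "sets \<mu> = sets borel"
  shows "jordan_decomposition (measure \<mu>) \<mu> (null_measure borel)"
proof -
  interpret finite_measure \<mu> by fact
  have "emeasure \<mu> (- UNIV) = 0" "emeasure (null_measure borel) UNIV = 0" by simp_all
  then have "\<exists>B\<in>sets borel. emeasure \<mu> (- B) = 0 \<and> emeasure (null_measure borel) B = 0"
    by (intro bexI[of _ UNIV]) auto
  then show ?thesis
    using assms by (auto simp: jordan_decomposition_def measure_def intro!: finite_measureI)
qed

text \<open>The supremum is attained at the constant 1. The sign of \<open>c\<close> is left open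
  because \<open>c\<close> will be a difference of two marginal densities.\<close>

lemma W_norm_scaled_prob:
  fixes \<nu> :: "'k::metric_space measure"
  assumes "prob_space \<nu>" and sets: "sets \<nu> = sets borel"
  shows "W_norm \<zeta> (\<lambda>A. c * measure \<nu> A) = ennreal \<bar>c\<bar>"
proof -
  interpret prob_space \<nu> by fact
  have space: "space \<nu> = UNIV" using sets_eq_imp_space_eq[OF sets] by simp
  define scaled where "scaled r = density \<nu> (\<lambda>_. ennreal r)" for r
  have jordan: "jordan_decomposition (\<lambda>A. c * measure \<nu> A) (scaled (max c 0)) (scaled (max (- c) 0))"
  proof -
    have em: "emeasure (scaled r) A = ennreal r * emeasure \<nu> A" if "A \<in> sets borel" for r A
      using that sets by (simp add: scaled_def emeasure_density nn_integral_cmult)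
    have fin: "finite_measure (scaled r)" for r
    proof (rule finite_measureI)
      have "space (scaled r) = UNIV" by (simp add: scaled_def space)
      then show "emeasure (scaled r) (space (scaled r)) \<noteq> \<infinity>"
        using em[of UNIV r] by (simp add: ennreal_mult_eq_top_iff)
    qed
    have me: "measure (scaled r) A = r * measure \<nu> A" if "A \<in> sets borel" "r \<ge> 0" for r A
      using em[OF that(1), of r] that(2) by (simp add: measure_def enn2real_mult)
    show ?thesis
      unfolding jordan_decomposition_def
    proof (intro conjI ballI)
      show "\<exists>B\<in>sets borel. emeasure (scaled (max c 0)) (- B) = 0 \<and> emeasure (scaled (max (- c) 0)) B = 0"
        by (rule bexI[of _ "if c \<ge> 0 then UNIV else {}"]) (auto simp: em max_def)
      show "c * measure \<nu> A = measure (scaled (max c 0)) A - measure (scaled (max (- c) 0)) A"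
        if "A \<in> sets borel" for A
        using me[OF that] by (simp add: max_def)
    qed (simp_all only: fin, simp_all add: scaled_def sets)
  qed
  \<comment> \<open>For general \<zeta> the test functions need not be measurable; a nonmeasurable
    one has integral 0 with respect to both measures, so the formula persists.\<close>
  have int: "(\<integral>z. u z \<partial>scaled r) = r * (\<integral>z. u z \<partial>\<nu>)" if "r \<ge> 0" for r and u :: "'k \<Rightarrow> real"
  proof (cases "u \<in> borel_measurable \<nu>")
    case True
    then show ?thesis unfolding scaled_def using that by (subst integral_density) auto
  next
    case False
    then have "\<not> integrable \<nu> u" "\<not> integrable (scaled r) u"
      by (auto simp: scaled_def dest: borel_measurable_integrable)
    then show ?thesis by (simp add: not_integrable_integral_eq)
  qed
  have signed: "signed_integral (\<lambda>A. c * measure \<nu> A) u = c * (\<integral>z. u z \<partial>\<nu>)" for u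
    unfolding signed_integral_def jordan_pos_neg[OF jordan] by (subst (1 2) int) (auto simp: max_def)
  have bound: "\<bar>\<integral>z. u z \<partial>\<nu>\<bar> \<le> 1" if u: "\<forall>z. \<bar>u z\<bar> \<le> 1" for u :: "'k \<Rightarrow> real"
  proof (cases "integrable \<nu> u")
    case True
    have "\<bar>\<integral>z. u z \<partial>\<nu>\<bar> \<le> (\<integral>z. \<bar>u z\<bar> \<partial>\<nu>)"
      using integral_norm_bound[of \<nu> u] by simp
    also have "\<dots> \<le> (\<integral>z. 1 \<partial>\<nu>)"
      using True u by (intro integral_mono) auto
    finally show ?thesis by (simp add: prob_space)
  qed (simp add: not_integrable_integral_eq)
  show ?thesis
    unfolding W_norm_def signed
  proof (rule antisym)
    show "(SUP u\<in>{u. (\<forall>z. \<bar>u z\<bar> \<le> 1) \<and> holder_const \<zeta> u \<le> 1}. ennreal \<bar>c * (\<integral>z. u z \<partial>\<nu>)\<bar>) \<le> ennreal \<bar>c\<bar>"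
      using bound by (intro SUP_least ennreal_leI) (auto simp: abs_mult intro: mult_left_le)
    have "holder_const \<zeta> (\<lambda>_::'k. 1) \<le> 1"
      unfolding holder_const_def by (rule SUP_least) auto
    then show "ennreal \<bar>c\<bar> \<le> (SUP u\<in>{u. (\<forall>z. \<bar>u z\<bar> \<le> 1) \<and> holder_const \<zeta> u \<le> 1}. ennreal \<bar>c * (\<integral>z. u z \<partial>\<nu>)\<bar>)"
      by (intro SUP_upper2[of "\<lambda>_. 1"]) (auto simp: prob_space)
  qed
qed

text \<open>A common kernel for both parts makes the restriction a multiple of one probability
  measure, the form that \<open>W_norm_scaled_prob\<close> handles.\<close>

lemma signed_leaf_restriction_eq:
  fixes \<kappa> :: "'m::topological_space \<Rightarrow> ('m \<times> 'k::topological_space) measure"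
  assumes "sets (\<kappa> x) = sets borel"
  shows "signed_leaf_restriction m \<mu> \<kappa> \<kappa> x =
    (\<lambda>A. (marginal_density m (jordan_pos \<mu>) x - marginal_density m (jordan_neg \<mu>) x) *
      measure (distr (\<kappa> x) borel snd) A)"
proof
  fix A :: "'k set"
  have [measurable_cong]: "sets (\<kappa> x) = sets borel" by fact
  have "measure (leaf_restriction m P \<kappa> x) A = marginal_density m P x * measure (distr (\<kappa> x) borel snd) A"
    for P :: "('m \<times> 'k) measure"
  proof (cases "A \<in> sets borel")
    case True
    then show ?thesis
      by (simp add: leaf_restriction_def measure_def emeasure_distr enn2real_mult marginal_density_def
          space_scale_measure)
  qed (simp add: leaf_restriction_def measure_notin_sets)
  then show "signed_leaf_restriction m \<mu> \<kappa> \<kappa> x A =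
    (marginal_density m (jordan_pos \<mu>) x - marginal_density m (jordan_neg \<mu>) x) *
      measure (distr (\<kappa> x) borel snd) A"
    by (simp add: signed_leaf_restriction_def left_diff_distrib)
qed

lemma signed_borel_measure_measure:
  assumes "finite_measure \<mu>" "sets \<mu> = sets borel"
  shows "signed_borel_measure (measure \<mu>)"
  using assms finite_measure.finite_measure_UNION[of \<mu>]
  by (auto simp: signed_borel_measure_def measure_notin_sets)

lemma distr_null_measure:
  "g \<in> borel \<rightarrow>\<^sub>M borel \<Longrightarrow> distr (null_measure borel) borel g = null_measure borel"
  by (rule measure_eqI) (auto simp: emeasure_distr)

context jacobian_system
begin

lemma marginal_density_AE:
  assumes [measurable]: "h \<in> borel_measurable borel" and "\<And>x. 0 \<le> h x"
    and "density m (\<lambda>x. ennreal (h x)) = distr \<mu> borel fst"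
  shows "AE x in m. marginal_density m \<mu> x = h x"
proof -
  have "AE x in m. ennreal (h x) = RN_deriv m (distr \<mu> borel fst) x"
    using assms(3) by (intro RN_deriv_unique) auto
  then show ?thesis
  proof eventually_elim
    case (elim x)
    then show ?case by (simp add: marginal_density_def assms(2) flip: elim)
  qed
qed

lemma marginal_density_null: "AE x in m. marginal_density m (null_measure borel) x = 0"
  by (rule marginal_density_AE) (auto simp: distr_null_measure null_measure_eq_density[symmetric]
      intro!: measure_eqI)

end

context contracting_skew_system
begin

section \<open>Membership of the limit measure in \<open>S_infty\<close>\<close>

lemma prob_limit_measure: "prob_space limit_measure"
  and sets_limit_measure: "sets limit_measure = sets borel"
  using limit_measure_invariant by (simp_all add: invariant_borel_prob_def)

lemma jordan_limit_measure:
  "jordan_pos (measure limit_measure) = limit_measure"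
  "jordan_neg (measure limit_measure) = null_measure borel"
  using jordan_pos_neg[OF jordan_decomposition_measure[OF _ sets_limit_measure]] prob_limit_measure
  by (simp_all add: prob_space_def)

lemma marginal_density_limit_measure: "AE x in m. marginal_density m limit_measure x = 1"
  by (rule marginal_density_AE) (simp_all add: limit_measure_marginal density_1)

lemma rokhlin_limit_measure: "rokhlin_disintegration m limit_measure kernel"
proof -
  have "density m (\<lambda>x. ennreal (marginal_density m limit_measure x)) = density m (\<lambda>_. 1)"
    using marginal_density_limit_measure
    by (intro density_cong) (auto simp: marginal_density_def elim!: eventually_mono)
  then show ?thesis
    unfolding rokhlin_disintegration_def
    using prob_space_kernel kernel_concentrated emeasure_limit_measure
    by (simp add: density_1 kernel_def)
qed

lemma rokhlin_null_measure: "rokhlin_disintegration m (null_measure borel) kernel"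
proof -
  have "density m (\<lambda>x. ennreal (marginal_density m (null_measure borel :: ('m \<times> 'k) measure) x)) = density m (\<lambda>_. 0)"
    using marginal_density_null
    by (intro density_cong) (auto simp: marginal_density_def elim!: eventually_mono)
  then show ?thesis
    unfolding rokhlin_disintegration_def
    using prob_space_kernel kernel_concentrated emeasure_limit_measure(1)
    by (simp add: nn_integral_density kernel_def)
qed

text \<open>The zero measure, as negative part, may be disintegrated along the same kernel. The norms of the
  leaf restrictions are then absolute values of differences of two densities, hence measurable, as
  the essential supremum requires.\<close>

lemma L_infty_norm_limit_measure: "L_infty_norm \<zeta> m (measure limit_measure) \<le> 1"
proof -
  let ?p = "marginal_density m limit_measure"
    and ?n = "marginal_density m (null_measure borel :: ('m \<times> 'k) measure)"
  have null: "AE x in m. ?n x = 0" by (rule marginal_density_null)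
  have "prob_space (distr (kernel x) borel snd)" for x
  proof -
    show ?thesis
      by (rule prob_space.prob_space_distr[OF prob_space_kernel]) (simp add: kernel_def)
  qed
  then have W: "W_norm \<zeta> (signed_leaf_restriction m (measure limit_measure) kernel kernel x) = ennreal \<bar>?p x - ?n x\<bar>" for x
    by (subst signed_leaf_restriction_eq) (simp_all add: kernel_def W_norm_scaled_prob jordan_limit_measure)
  \<comment> \<open>The norm is an infimum over disintegrations, so one admissible pair bounds
    it.\<close>
  have "L_infty_norm \<zeta> m (measure limit_measure)
      \<le> esssup m (\<lambda>x. W_norm \<zeta> (signed_leaf_restriction m (measure limit_measure) kernel kernel x))"
    unfolding L_infty_norm_def jordan_limit_measure
    by (rule INF_lower2[of "(kernel, kernel)"]) (simp_all add: rokhlin_limit_measure rokhlin_null_measure)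
  also have "\<dots> \<le> 1"
    unfolding W
  proof (rule esssup_I)
    show "(\<lambda>x. ennreal \<bar>?p x - ?n x\<bar>) \<in> borel_measurable m"
      unfolding marginal_density_def by measurable
    show "AE x in m. ennreal \<bar>?p x - ?n x\<bar> \<le> 1"
      using marginal_density_limit_measure null by eventually_elim simp
  qed
  finally show ?thesis .
qed

lemma limit_measure_S_infty: "measure limit_measure \<in> S_infty \<zeta> m"
proof -
  have "holder_const \<zeta> (\<lambda>_::'m. 1) \<le> 0"
    unfolding holder_const_def by (rule SUP_least) auto
  then have "(\<lambda>_::'m. 1) \<in> holder_space \<zeta>"
    by (simp add: holder_space_def)
  moreover have "AE x in m. marginal_density m (null_measure borel :: ('m \<times> 'k) measure) x = 0"
    by (rule marginal_density_null)
  with marginal_density_limit_measure have "AE x in m. marginal_density m limit_measure x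
      - marginal_density m (null_measure borel :: ('m \<times> 'k) measure) x = 1"
    by eventually_elim simp
  moreover have "signed_borel_measure (measure limit_measure)"
    using prob_limit_measure sets_limit_measure
    by (intro signed_borel_measure_measure) (simp_all add: prob_space_def)
  moreover have "absolutely_continuous m (distr (null_measure borel :: ('m \<times> 'k) measure) borel fst)"
    by (auto simp: absolutely_continuous_def distr_null_measure null_sets_def)
  moreover have "L_infty_norm \<zeta> m (measure limit_measure) < \<infinity>"
    using L_infty_norm_limit_measure[of \<zeta>] by (rule order_le_less_trans) simp
  ultimately show ?thesis
    by (auto simp: S_infty_def L_infty_def AB_space_def jordan_limit_measure limit_measure_marginal
        absolutely_continuous_def)
qed

end

section \<open>The marginal of an invariant measure\<close>

lemma holder_const_bound:
  assumes "h \<in> holder_space \<zeta>"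
  shows "\<bar>h x - h y\<bar> \<le> enn2real (holder_const \<zeta> h) * dist x y powr \<zeta>"
proof (cases "x = y")
  case False
  have "ennreal (\<bar>h x - h y\<bar> / dist x y powr \<zeta>) \<le> holder_const \<zeta> h"
    unfolding holder_const_def using False by (intro SUP_upper2[of "(x, y)"]) auto
  then have "\<bar>h x - h y\<bar> / dist x y powr \<zeta> \<le> enn2real (holder_const \<zeta> h)"
    using assms by (metis enn2real_ennreal enn2real_mono holder_space_def mem_Collect_eq
        divide_nonneg_nonneg abs_ge_zero powr_ge_zero infinity_ennreal_def)
  then show ?thesis using False by (simp add: pos_divide_le_eq)
qed simp

lemma continuous_on_holder:
  fixes h :: "'a::metric_space \<Rightarrow> real"
  assumes "h \<in> holder_space \<zeta>" "0 < \<zeta>"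
  shows "continuous_on UNIV h"
  unfolding continuous_on_def
proof
  fix x :: 'a
  have "((\<lambda>y. dist y x) \<longlongrightarrow> dist x x) (at x)"
    by (intro tendsto_intros)
  then have "((\<lambda>y. dist y x) \<longlongrightarrow> 0) (at x)"
    by simp
  then have "((\<lambda>y. dist y x powr \<zeta>) \<longlongrightarrow> 0) (at x)"
    by (rule tendsto_zero_powrI) (use assms in auto)
  then have "((\<lambda>y. enn2real (holder_const \<zeta> h) * dist y x powr \<zeta>) \<longlongrightarrow> 0) (at x)"
    by (rule tendsto_mult_right_zero)
  then have "((\<lambda>y. h y - h x) \<longlongrightarrow> 0) (at x)"
    by (rule Lim_null_comparison[rotated]) (simp add: holder_const_bound[OF assms(1)])
  then show "(h \<longlongrightarrow> h x) (at x)" by (simp add: LIM_zero_iff)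
qed

lemma holder_norm_finite:
  fixes h :: "'a::metric_space \<Rightarrow> real"
  assumes "h \<in> holder_space \<zeta>" "0 < \<zeta>" "compact (UNIV :: 'a set)"
  shows "holder_norm \<zeta> h < \<infinity>"
proof -
  have "bounded (range h)"
    using continuous_on_holder[OF assms(1,2)] assms(3)
    by (intro compact_imp_bounded compact_continuous_image)
  then obtain B where "\<And>x. \<bar>h x\<bar> \<le> B" by (auto simp: bounded_iff)
  then have "(SUP x. ennreal \<bar>h x\<bar>) \<le> ennreal B" by (intro SUP_least ennreal_leI)
  then have "(SUP x. ennreal \<bar>h x\<bar>) < \<infinity>" by (rule order_le_less_trans) simp
  then show ?thesis using assms(1) by (simp add: holder_norm_def holder_space_def)
qed

lemma holder_space_diff_const: "(\<lambda>x. h x - c) \<in> holder_space \<zeta> \<longleftrightarrow> h \<in> holder_space \<zeta>"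
  by (simp add: holder_space_def holder_const_def)

lemma abs_le_holder_norm: "ennreal \<bar>h x\<bar> \<le> holder_norm \<zeta> h"
  unfolding holder_norm_def by (intro add_increasing SUP_upper) auto

section \<open>Fixed densities of the Perron-Frobenius operator\<close>

context jacobian_system
begin

text \<open>Invariance gives a fixed point of the extended nonnegative operator
  \<open>transfer\<close>. Returning to reals needs \<open>h\<close> nonnegative at \<open>x\<close>
  and at all its preimages, which \<open>AE_preimages\<close> ensures for almost every
  \<open>x\<close>.\<close>

lemma perron_frobenius_invariant:
  assumes [measurable]: "h \<in> borel_measurable borel" and "AE x in m. 0 \<le> h x"
    and "distr (density m (\<lambda>x. ennreal (h x))) borel f = density m (\<lambda>x. ennreal (h x))"
  shows "AE x in m. perron_frobenius f \<rho> h x = h x"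
proof -
  have "AE x in m. transfer f \<rho> (\<lambda>x. ennreal (h x)) x = ennreal (h x)"
    using assms(3) by (intro transfer_invariant) measurable
  then show ?thesis
    using assms(2) AE_preimages[OF assms(2)]
  proof eventually_elim
    case (elim x)
    have "transfer f \<rho> (\<lambda>x. ennreal (h x)) x = (\<Sum>y\<in>f -` {x}. ennreal (h y * \<rho> y))"
      unfolding transfer_def using elim(3) \<rho>_pos
      by (intro sum.cong) (simp_all add: ennreal_mult less_imp_le mult.commute)
    also have "\<dots> = ennreal (perron_frobenius f \<rho> h x)"
      unfolding perron_frobenius_def using elim(3) \<rho>_pos
      by (intro sum_ennreal) (simp add: less_imp_le)
    finally have "ennreal (perron_frobenius f \<rho> h x) = ennreal (h x)"
      using elim(1) by simp
    moreover have "0 \<le> perron_frobenius f \<rho> h x"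
      unfolding perron_frobenius_def using elim(3) \<rho>_pos
      by (intro sum_nonneg) (simp add: less_imp_le)
    ultimately show ?case using elim(2) by (simp only: ennreal_inj)
  qed
qed

lemma perron_frobenius_one: "AE x in m. perron_frobenius f \<rho> (\<lambda>_. 1) x = 1"
  using distr_f by (intro perron_frobenius_invariant) (simp_all add: density_1)

lemma perron_frobenius_iterate:
  assumes "AE x in m. perron_frobenius f \<rho> h x = h x"
  shows "AE x in m. (perron_frobenius f \<rho> ^^ k) h x = h x"
proof (induction k)
  case (Suc k)
  show ?case
    using AE_preimages[OF Suc] assms
  proof eventually_elim
    case (elim x)
    have "(perron_frobenius f \<rho> ^^ Suc k) h x = perron_frobenius f \<rho> h x"
      unfolding funpow.simps comp_apply perron_frobenius_def[of _ _ _ x]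
      using elim(1) by (intro sum.cong) simp_all
    with elim(2) show ?case by simp
  qed
qed simp

text \<open>At almost every point \<open>\<phi>\<close> agrees with all its iterates, whose Hoelder
  norms tend to 0 and dominate their values at every point. The comparison is pointwise because the
  norm is not invariant under changes on null sets.\<close>

lemma AE_zero_of_contraction:
  assumes "AE x in m. perron_frobenius f \<rho> \<phi> x = \<phi> x"
    and "0 < r" "r < 1" "C < \<infinity>"
    and le: "\<And>k. k \<ge> 1 \<Longrightarrow> holder_norm \<zeta> ((perron_frobenius f \<rho> ^^ k) \<phi>) \<le> ennreal (D * r ^ k) * C"
  shows "AE x in m. \<phi> x = 0"
proof -
  have "AE x in m. \<forall>k. (perron_frobenius f \<rho> ^^ k) \<phi> x = \<phi> x"
    using perron_frobenius_iterate[OF assms(1)] by (simp add: AE_all_countable)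
  then show ?thesis
  proof eventually_elim
    case (elim x)
    \<comment> \<open>The absolute value of \<open>D\<close> appears since its sign is not assumed
      here.\<close>
    have bound: "\<bar>\<phi> x\<bar> \<le> \<bar>D\<bar> * r ^ k * enn2real C" if "k \<ge> 1" for k
    proof -
      have "ennreal \<bar>\<phi> x\<bar> = ennreal \<bar>(perron_frobenius f \<rho> ^^ k) \<phi> x\<bar>"
        using elim by simp
      also have "\<dots> \<le> holder_norm \<zeta> ((perron_frobenius f \<rho> ^^ k) \<phi>)"
        by (rule abs_le_holder_norm)
      also have "\<dots> \<le> ennreal (D * r ^ k) * C" by (rule le[OF that])
      also have "\<dots> \<le> ennreal (\<bar>D\<bar> * r ^ k) * ennreal (enn2real C)"
        using assms(2,4) by (intro mult_mono ennreal_leI) (auto intro: mult_right_mono)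
      also have "\<dots> = ennreal (\<bar>D\<bar> * r ^ k * enn2real C)"
        using assms(2) by (intro ennreal_mult[symmetric]) auto
      finally show ?thesis
        using assms(2) by (subst (asm) ennreal_le_iff) auto
    qed
    have "(\<lambda>k. \<bar>D\<bar> * r ^ k * enn2real C) \<longlonglongrightarrow> 0"
      using assms(2,3) by (intro tendsto_mult_left_zero tendsto_mult_right_zero LIMSEQ_power_zero) simp
    then have "\<bar>\<phi> x\<bar> \<le> 0"
      using bound by (intro LIMSEQ_le_const) auto
    then show ?case by simp
  qed
qed

text \<open>Subtracting 1 gives mean zero, \<open>h\<close> being a probability density, and keeps
  the function fixed, as the operator fixes 1 almost everywhere.\<close>

lemma invariant_density_eq_one:
  assumes [measurable]: "h \<in> borel_measurable borel" and nonneg: "AE x in m. 0 \<le> h x"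
    and inv: "distr (density m (\<lambda>x. ennreal (h x))) borel f = density m (\<lambda>x. ennreal (h x))"
    and prob: "prob_space (density m (\<lambda>x. ennreal (h x)))"
    and gap: "0 < r" "r < 1" "holder_norm \<zeta> (\<lambda>x. h x - 1) < \<infinity>"
      "\<And>k. k \<ge> 1 \<Longrightarrow> (\<integral>x. h x - 1 \<partial>m) = 0 \<Longrightarrow>
        holder_norm \<zeta> ((perron_frobenius f \<rho> ^^ k) (\<lambda>x. h x - 1)) \<le> ennreal (D * r ^ k) * holder_norm \<zeta> (\<lambda>x. h x - 1)"
  shows "AE x in m. h x = 1"
proof -
  have int_h: "(\<integral>\<^sup>+x. ennreal (h x) \<partial>m) = 1"
    using prob_space.emeasure_space_1[OF prob] by (simp add: emeasure_density)
  then have "integrable m h"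
    using nonneg by (intro integrableI_nonneg) auto
  moreover have "(\<integral>x. h x \<partial>m) = 1"
    using nonneg int_h by (subst integral_eq_nn_integral) auto
  ultimately have int0: "(\<integral>x. h x - 1 \<partial>m) = 0" by (simp add: prob_space[simplified])
  have "AE x in m. perron_frobenius f \<rho> h x = h x"
    using nonneg inv by (intro perron_frobenius_invariant) measurable
  then have "AE x in m. perron_frobenius f \<rho> (\<lambda>x. h x - 1) x = h x - 1"
    using perron_frobenius_one
    by eventually_elim (simp add: perron_frobenius_def left_diff_distrib sum_subtractf)
  then have "AE x in m. h x - 1 = 0"
    by (rule AE_zero_of_contraction[OF _ gap(1,2,3) gap(4)[OF _ int0]])
  then show ?thesis by eventually_elim simp
qed

text \<open>\<open>fst\<close> intertwines the skew product with \<open>f\<close>, so the marginal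
  is \<open>f\<close>-invariant; membership in \<open>S_infty\<close> gives its density a Hoelder
  version, to which the spectral gap applies.\<close>

lemma S_infty_invariant_marginal:
  fixes G :: "'m \<times> 'k::metric_space \<Rightarrow> 'k"
  assumes compact: "compact (UNIV :: 'm set)" and \<zeta>: "0 < \<zeta>"
    and gap: "\<exists>r D. 0 < r \<and> r < 1 \<and> 0 < D \<and>
          (\<forall>n\<ge>1. \<forall>\<phi>\<in>holder_space \<zeta>. (\<integral>x. \<phi> x \<partial>m) = 0 \<longrightarrow>
             holder_norm \<zeta> ((perron_frobenius f \<rho> ^^ n) \<phi>) \<le> ennreal (D * r ^ n) * holder_norm \<zeta> \<phi>)"
    and inv: "invariant_borel_prob (skew_product f G) \<mu>" and S: "measure \<mu> \<in> S_infty \<zeta> m"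
  shows "distr \<mu> borel fst = m"
proof -
  interpret \<mu>: prob_space \<mu> using inv by (simp add: invariant_borel_prob_def)
  have sets_\<mu>: "sets \<mu> = sets borel" and F [measurable]: "skew_product f G \<in> borel \<rightarrow>\<^sub>M borel"
    and distr_F: "distr \<mu> borel (skew_product f G) = \<mu>"
    using inv by (simp_all add: invariant_borel_prob_def)
  have fst_\<mu>: "fst \<in> \<mu> \<rightarrow>\<^sub>M borel"
    unfolding measurable_cong_sets[OF sets_\<mu> refl] by (rule fst_borel)
  have F_\<mu>: "skew_product f G \<in> \<mu> \<rightarrow>\<^sub>M borel"
    unfolding measurable_cong_sets[OF sets_\<mu> refl] by (rule F)
  have jordan: "jordan_pos (measure \<mu>) = \<mu>" "jordan_neg (measure \<mu>) = null_measure borel"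
    using jordan_pos_neg[OF jordan_decomposition_measure[OF _ sets_\<mu>]] \<mu>.finite_measure_axioms
    by simp_all
  let ?\<nu> = "distr \<mu> borel fst"
  interpret \<nu>: prob_space ?\<nu> using fst_\<mu> by (rule \<mu>.prob_space_distr)
  have ac: "absolutely_continuous m ?\<nu>"
    using S by (simp add: S_infty_def L_infty_def AB_space_def jordan)
  obtain h where h: "h \<in> holder_space \<zeta>"
    and h_eq: "AE x in m. marginal_density m \<mu> x - marginal_density m (null_measure borel :: ('m \<times> 'k) measure) x = h x"
    using S by (auto simp: S_infty_def jordan)
  have [measurable]: "h \<in> borel_measurable borel"
    using continuous_on_holder[OF h \<zeta>] by (rule borel_measurable_continuous_onI)
  have null: "AE x in m. marginal_density m (null_measure borel :: ('m \<times> 'k) measure) x = 0"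
    by (rule marginal_density_null)
  \<comment> \<open>\<open>marginal_density\<close> passes through \<open>enn2real\<close>, which
    loses nothing where the Radon-Nikodym derivative is finite.\<close>
  have fin: "AE x in m. RN_deriv m ?\<nu> x \<noteq> \<infinity>"
    using \<nu>.sigma_finite_measure_axioms ac by (rule RN_deriv_finite) simp
  have h_RN: "AE x in m. ennreal (h x) = RN_deriv m ?\<nu> x \<and> 0 \<le> h x"
    using h_eq null fin
  proof eventually_elim
    case (elim x)
    then have "h x = enn2real (RN_deriv m ?\<nu> x)" by (simp add: marginal_density_def)
    with elim(3) show ?case by (simp add: less_top)
  qed
  then have nonneg: "AE x in m. 0 \<le> h x" by eventually_elim simp
  have "density m (\<lambda>x. ennreal (h x)) = density m (RN_deriv m ?\<nu>)"
    using h_RN by (intro density_cong) (auto elim!: eventually_mono)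
  also have "\<dots> = ?\<nu>" using ac by (rule density_RN_deriv) simp
  finally have density_h: "density m (\<lambda>x. ennreal (h x)) = ?\<nu>" .
  have "distr ?\<nu> borel f = distr \<mu> borel (f \<circ> fst)"
    using f_borel fst_\<mu> by (rule distr_distr)
  also have "f \<circ> fst = fst \<circ> skew_product f G"
    by (auto simp: skew_product_def)
  also have "distr \<mu> borel (fst \<circ> skew_product f G) = distr (distr \<mu> borel (skew_product f G)) borel fst"
    using fst_borel F_\<mu> by (rule distr_distr[symmetric])
  finally have inv_h: "distr (density m (\<lambda>x. ennreal (h x))) borel f = density m (\<lambda>x. ennreal (h x))"
    by (simp only: density_h distr_F)
  from gap obtain r D where r: "0 < r" "r < 1" and D:
    "\<And>n \<phi>. \<lbrakk>n \<ge> 1; \<phi> \<in> holder_space \<zeta>; (\<integral>x. \<phi> x \<partial>m) = 0\<rbrakk> \<Longrightarrow>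
      holder_norm \<zeta> ((perron_frobenius f \<rho> ^^ n) \<phi>) \<le> ennreal (D * r ^ n) * holder_norm \<zeta> \<phi>"
    by blast
  have h_1: "(\<lambda>x. h x - 1) \<in> holder_space \<zeta>" using h by (simp add: holder_space_diff_const)
  have "AE x in m. h x = 1"
  proof (rule invariant_density_eq_one[where r=r and D=D and \<zeta>=\<zeta>])
    show "prob_space (density m (\<lambda>x. ennreal (h x)))"
      unfolding density_h by (rule \<nu>.prob_space_axioms)
    show "holder_norm \<zeta> (\<lambda>x. h x - 1) < \<infinity>"
      using h_1 \<zeta> compact by (rule holder_norm_finite)
    show "holder_norm \<zeta> ((perron_frobenius f \<rho> ^^ k) (\<lambda>x. h x - 1))
        \<le> ennreal (D * r ^ k) * holder_norm \<zeta> (\<lambda>x. h x - 1)"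
      if "k \<ge> 1" "(\<integral>x. h x - 1 \<partial>m) = 0" for k
      using that(1) h_1 that(2) by (rule D)
  qed (simp_all only: nonneg inv_h r, measurable)
  then have "density m (\<lambda>x. ennreal (h x)) = density m (\<lambda>_. 1)"
    by (intro density_cong) (auto elim!: eventually_mono)
  then show ?thesis by (simp add: density_h density_1)
qed

end

section \<open>Skew products over local diffeomorphisms\<close>

text \<open>Compactness leaves finitely many injectivity domains with continuous inverses, which are
  then made disjoint. Images of Borel sets are Borel, being preimages under those inverses.\<close>

lemma local_diffeomorphism_jacobian_system:
  fixes f :: "'m::metric_space \<Rightarrow> 'm"
  assumes "compact (UNIV :: 'm set)" "local_diffeomorphism C f"
    and "invariant_borel_prob f m" "jacobian_wrt m f J"
  obtains A n where "jacobian_system f J m A n"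
proof -
  obtain W where W: "\<And>x. open (W x)" "\<And>x. x \<in> W x" "\<And>x. open (f ` W x)" "\<And>x. inj_on f (W x)"
    "\<And>x. continuous_on (f ` W x) (inv_into (W x) f)"
  proof -
    have "\<forall>x. \<exists>W. open W \<and> x \<in> W \<and> open (f ` W) \<and> inj_on f W \<and> continuous_on (f ` W) (inv_into W f)"
    proof
      fix x
      obtain W where "open W" "x \<in> W" "open (f ` W)" "inj_on f W" "C1_map_on C (inv_into W f) (f ` W)"
        using assms(2) unfolding local_diffeomorphism_def by blast
      then show "\<exists>W. open W \<and> x \<in> W \<and> open (f ` W) \<and> inj_on f W \<and> continuous_on (f ` W) (inv_into W f)"
        by (intro exI[of _ W]) (simp add: C1_map_on_def)
    qed
    from choice[OF this] show ?thesis using that by blast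
  qed
  have "UNIV \<subseteq> (\<Union>x. W x)" using W(2) by auto
  then obtain T where T: "finite T" "UNIV \<subseteq> (\<Union>x\<in>T. W x)"
    using compactE_image[OF assms(1), of UNIV W] W(1) by metis
  obtain n :: nat and e where e: "T = e ` {i. i < n}"
    using finite_imp_nat_seg_image_inj_on[OF T(1)] by blast
  define V where "V i = (if i < n then W (e i) else {})" for i
  have V: "open (V i)" "open (f ` V i)" "inj_on f (V i)" "continuous_on (f ` V i) (inv_into (V i) f)" for i
    by (simp_all add: V_def W)
  have "(\<Union>i. V i) = UNIV"
  proof (intro equalityI subsetI UNIV_I)
    fix x
    obtain y where "y \<in> T" "x \<in> W y" using T(2) by blast
    then obtain i where "i < n" "x \<in> W (e i)" using e by blast
    then show "x \<in> (\<Union>i. V i)" by (intro UN_I[of i]) (simp_all add: V_def)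
  qed
  have image: "f ` B \<in> sets borel" if B: "B \<in> sets borel" "B \<subseteq> V i" for B i
  proof -
    have fV: "f ` V i \<in> sets borel" using V(2) by simp
    have "inv_into (V i) f -` B \<inter> space (restrict_space borel (f ` V i)) \<in> sets (restrict_space borel (f ` V i))"
      using borel_measurable_continuous_on_restrict[OF V(4)] B(1) by (rule measurable_sets)
    then have "inv_into (V i) f -` B \<inter> f ` V i \<in> sets borel"
      using fV by (simp add: sets_restrict_space_iff space_restrict_space)
    also have "inv_into (V i) f -` B \<inter> f ` V i = f ` B"
      using B(2) V(3)[of i] by (auto simp: inv_into_f_f subset_iff)
    finally show ?thesis .
  qed
  have "jacobian_system f J m (disjointed V) n"
  proof
    show "disjointed V i \<in> sets borel" for i
      using V(1) unfolding disjointed_def by (intro sets.Diff sets.finite_UN) auto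
    show "f ` B \<in> sets borel" if "B \<in> sets borel" "B \<subseteq> disjointed V i" for i B
      using image[of B i] that disjointed_subset[of V i] by blast
    show "inj_on f (disjointed V i)" for i
      using V(3) disjointed_subset by (rule inj_on_subset)
    show "disjointed V i = {}" if "n \<le> i" for i
      using that disjointed_subset[of V i] by (simp add: V_def)
  qed (use assms \<open>(\<Union>i. V i) = UNIV\<close> in \<open>simp_all add: disjoint_family_disjointed UN_disjointed_eq\<close>)
  then show ?thesis by (rule that)
qed

text \<open>The skew products agree \<open>\<mu>\<close>-almost everywhere and so push
  \<open>\<mu>\<close> to the same measure. If the sigma-algebra of \<open>\<mu>\<close> is not the
  Borel one, both sides are false.\<close>

lemma invariant_borel_prob_cong_AE:
  fixes f :: "'m::{metric_space, second_countable_topology} \<Rightarrow> 'm"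
    and G :: "'m \<times> 'k::{metric_space, second_countable_topology} \<Rightarrow> 'k"
  assumes [measurable]: "f \<in> borel \<rightarrow>\<^sub>M borel" "G \<in> borel \<rightarrow>\<^sub>M borel" "G' \<in> borel \<rightarrow>\<^sub>M borel"
    and AE: "AE x in distr \<mu> borel fst. \<forall>z. G (x, z) = G' (x, z)"
  shows "invariant_borel_prob (skew_product f G) \<mu> \<longleftrightarrow> invariant_borel_prob (skew_product f G') \<mu>"
proof (cases "sets \<mu> = sets borel")
  case True
  then have fst: "fst \<in> \<mu> \<rightarrow>\<^sub>M borel"
    and F: "skew_product f G \<in> \<mu> \<rightarrow>\<^sub>M borel" "skew_product f G' \<in> \<mu> \<rightarrow>\<^sub>M borel"
    by (simp_all add: measurable_cong_sets[OF True refl] fst_borel skew_product_borel)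
  from AE_distrD[OF fst AE] have "AE p in \<mu>. skew_product f G p = skew_product f G' p"
    by eventually_elim (auto simp: skew_product_def)
  then have "distr \<mu> borel (skew_product f G) = distr \<mu> borel (skew_product f G')"
    using F by (intro distr_cong_AE) auto
  then show ?thesis by (simp add: invariant_borel_prob_def skew_product_borel)
qed (simp add: invariant_borel_prob_def)

theorem theorem1:
  fixes \<zeta> \<sigma> L \<epsilon> \<alpha> :: real and q :: nat
    and C :: "('m::{metric_space, second_countable_topology}, 'e::euclidean_space) chart set"
    and g :: "('m, 'e) metric_tensor"
    and f :: "'m \<Rightarrow> 'm" and \<l> :: "'m \<Rightarrow> real" and \<A> :: "'m set"
    and m1 :: "'m measure" and J \<rho> :: "'m \<Rightarrow> real"
    and G :: "'m \<times> 'k \<Rightarrow> 'k::{metric_space, second_countable_topology}"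
  assumes "0 < \<zeta>" "\<zeta> < 1"
    and "riemannian_manifold C g"
    and "compact (UNIV :: 'm set)" "connected (UNIV :: 'm set)" "diameter (UNIV :: 'm set) = 1"
    and "local_diffeomorphism C f"
    and "continuous_on UNIV \<l>"
    and "\<And>x. \<exists>U. open U \<and> x \<in> U \<and> inj_on f U \<and>
           (\<forall>y\<in>f ` U. \<forall>z\<in>f ` U. dist (inv_into U f y) (inv_into U f z) \<le> \<l> x * dist y z)"
    and "open \<A>" "1 < \<sigma>" "1 \<le> L" "0 < \<epsilon>" "q < map_degree f"
    and f1: "\<And>x. x \<in> \<A> \<Longrightarrow> \<l> x \<le> L" "\<And>x. x \<notin> \<A> \<Longrightarrow> \<l> x < inverse \<sigma>"
    and f2: "\<exists>\<U>. finite \<U> \<and> (\<forall>U\<in>\<U>. open U \<and> inj_on f U) \<and> \<Union>\<U> = UNIV \<and>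
               (\<exists>\<V>\<subseteq>\<U>. card \<V> = q \<and> \<A> \<subseteq> \<Union>\<V>)"
    and "maximal_entropy_measure f m1"
    and "\<exists>\<nu>. conformal_measure f \<nu> \<and> absolutely_continuous \<nu> m1"
    and "jacobian_wrt m1 f J" "\<rho> = (\<lambda>x. 1 / J x)"
    and f3: "(SUP x. ln (\<rho> x)) - (INF x. ln (\<rho> x)) < \<epsilon>"
            "holder_const \<zeta> \<rho> < ennreal (\<epsilon> * (INF x. \<rho> x))"
    and "exp \<epsilon> * (((real (map_degree f) - real q) * \<sigma> powr (- \<zeta>)
            + real q * L powr \<zeta> * (1 + (L - 1) powr \<zeta>)) / real (map_degree f)) < 1"
    and spectral_gap: "\<exists>r D. 0 < r \<and> r < 1 \<and> 0 < D \<and>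
          (\<forall>n\<ge>1. \<forall>\<phi>\<in>holder_space \<zeta>. (\<integral>x. \<phi> x \<partial>m1) = 0 \<longrightarrow>
             holder_norm \<zeta> ((perron_frobenius f \<rho> ^^ n) \<phi>) \<le> ennreal (D * r ^ n) * holder_norm \<zeta> \<phi>)"
    and "compact (UNIV :: 'k set)"
    and "G \<in> borel \<rightarrow>\<^sub>M borel"
    and G1: "0 < \<alpha>" "\<alpha> < 1"
            "AE x in m1. \<forall>z1 z2. dist (G (x, z1)) (G (x, z2)) \<le> \<alpha> * dist z1 z2"
  shows "(\<exists>!\<mu>0. invariant_borel_prob (skew_product f G) \<mu>0 \<and> measure \<mu>0 \<in> S_infty \<zeta> m1) \<and>
         (\<forall>\<mu>0. invariant_borel_prob (skew_product f G) \<mu>0 \<and> measure \<mu>0 \<in> S_infty \<zeta> m1 \<longrightarrow>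
            distr \<mu>0 borel fst = m1)"
proof -
  have "invariant_borel_prob f m1"
    using \<open>maximal_entropy_measure f m1\<close> by (simp add: maximal_entropy_measure_def)
  with \<open>compact (UNIV :: 'm set)\<close> \<open>local_diffeomorphism C f\<close> obtain A n
    where system: "jacobian_system f J m1 A n"
    using \<open>jacobian_wrt m1 f J\<close> by (rule local_diffeomorphism_jacobian_system)
  interpret base: jacobian_system f J m1 A n by (rule system)
  have \<rho>: "\<rho> = base.\<rho>"
    by (simp add: \<open>\<rho> = (\<lambda>x. 1 / J x)\<close> base.\<rho>_def fun_eq_iff)
  obtain N where "{x\<in>space m1. \<not> (\<forall>z1 z2. dist (G (x, z1)) (G (x, z2)) \<le> \<alpha> * dist z1 z2)} \<subseteq> N"
    and N: "emeasure m1 N = 0" "N \<in> sets m1"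
    using G1(3) by (rule AE_E)
  then have G_N: "dist (G (x, z1)) (G (x, z2)) \<le> \<alpha> * dist z1 z2" if "x \<notin> N" for x z1 z2
    using that by auto
  have [measurable]: "N \<in> sets borel" using N(2) by simp
  \<comment> \<open>On the exceptional leaves \<open>G'\<close> is constant, which is trivially a
    contraction.\<close>
  define G' where "G' p = (if fst p \<in> N then undefined else G p)" for p
  have "fst -` N \<inter> space borel \<in> sets (borel :: ('m \<times> 'k) measure)"
    using fst_borel by (rule measurable_sets) measurable
  then have G'_borel: "G' \<in> borel \<rightarrow>\<^sub>M borel"
    unfolding G'_def using \<open>G \<in> borel \<rightarrow>\<^sub>M borel\<close> by (intro measurable_If) (simp_all add: vimage_def)
  interpret skew: contracting_skew_system f J m1 A n G' \<alpha>
  proof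
    show "dist (G' (x, z1)) (G' (x, z2)) \<le> \<alpha> * dist z1 z2" for x z1 z2
      using G_N[of x] G1(1) by (simp add: G'_def)
  qed (use G'_borel G1 \<open>compact (UNIV :: 'k set)\<close> in auto)
  have "AE x in m1. x \<notin> N" using N by (intro AE_not_in) auto
  then have eq: "AE x in m1. \<forall>z. G (x, z) = G' (x, z)"
    by eventually_elim (simp add: G'_def)
  have inv_iff: "invariant_borel_prob (skew_product f G) \<mu> \<longleftrightarrow> invariant_borel_prob (skew_product f G') \<mu>"
    if "distr \<mu> borel fst = m1" for \<mu>
    using base.f_borel \<open>G \<in> borel \<rightarrow>\<^sub>M borel\<close> G'_borel
    by (rule invariant_borel_prob_cong_AE) (subst that, rule eq)
  \<comment> \<open>Obtained for \<open>G\<close> itself, since exchanging \<open>G\<close> and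
    \<open>G'\<close> by \<open>inv_iff\<close> presupposes this marginal.\<close>
  have marginal: "distr \<mu> borel fst = m1"
    if "invariant_borel_prob (skew_product f G) \<mu>" "measure \<mu> \<in> S_infty \<zeta> m1" for \<mu>
    using \<open>compact (UNIV :: 'm set)\<close> \<open>0 < \<zeta>\<close> spectral_gap[unfolded \<rho>] that
    by (rule base.S_infty_invariant_marginal)
  have "invariant_borel_prob (skew_product f G) skew.limit_measure"
    using skew.limit_measure_invariant inv_iff[OF skew.limit_measure_marginal] by simp
  then show ?thesis
    using marginal skew.limit_measure_S_infty inv_iff skew.invariant_unique by metis
qed

end
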